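(* The category $\mathbb{M}$, together with the exponentiable object $(0)\in\mathbb{M}$, is initial (up to isomorphism) amongst cartesian categories equipped with an exponentiable object, with respect to cartesian functors that preserve the exponentiable object. That is: for every cartesian category $\mathscr{D}$ equipped with an exponentiable object $D$, there exists a cartesian functor $I:\mathbb{M}\to\mathscr{D}$ that preserves the exponentiable object $(0)$ and satisfies $I(0)\cong D$, and any two such functors are naturally isomorphic.
   Context: Cartesian categories and functors. A cartesian category is a category with (chosen) finite products; a cartesian functor preserves finite products up to canonical isomorphism. An object $C$ of a cartesian category $\mathscr{C}$ is exponentiable if for every object $B$ the exponential $C\Rightarrow B$, with evaluation $\mathrm{ev}:(C\Rightarrow B)\times C\to B$, exists in $\mathscr{C}$: for every $f:A\times C\to B$ there is a unique $\lambda(f):A\to (C\Rightarrow B)$ (the exponential mate of $f$) with $\mathrm{ev}\circ(\lambda(f)\times C)=f$. A cartesian functor $F:\mathbb{M}\to\mathscr{D}$ preserves the exponentiable object $(0)$ if $F(0)$ is exponentiable in $\mathscr{D}$ and, for each object $B$ of $\mathbb{M}$, the exponential mate $F((0)\Rightarrow B)\to (F(0)\Rightarrow F(B))$ of $F((0)\Rightarrow B)\times F(0)\cong F(((0)\Rightarrow B)\times(0))\xrightarrow{F(\mathrm{ev})}F(B)$ is an isomorphism. Elementary second-order terms. A context $\Theta\triangleright\Gamma$ consists of a list $\Theta=\mathsf{m}_1:[m_1],\dots,\mathsf{m}_k:[m_k]$ of distinct metavariables with meta-arities $m_i\in\mathbb{N}$ and a list $\Gamma=x_1,\dots,x_n$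 of distinct variables. Elementary terms (those over the empty second-order signature) are generated by: $\Theta\triangleright\Gamma\vdash x$ for each variable $x\in\Gamma$; and, for $(\mathsf{m}:[m])\in\Theta$, if $\Theta\triangleright\Gamma\vdash t_i$ for $1\le i\le m$ then $\Theta\triangleright\Gamma\vdash\mathsf{m}[t_1,\dots,t_m]$. Substitution $t\{x_i:=t_i\}$ of terms for variables is the usual simultaneous one. Metasubstitution $t\{\mathsf{m}_i:=(\vec{x}_i)t_i\}_{1\le i\le k}$, where $t$ has metavariables $\mathsf{m}_1:[m_1],\dots,\mathsf{m}_k:[m_k]$ and $\Theta\triangleright\Gamma,\vec{x}_i\vdash t_i$ with $\vec{x}_i=x^{(i)}_1,\dots,x^{(i)}_{m_i}$, is defined by: $x$ is mapped to $x$; $\mathsf{m}_l[s_1,\dots,s_{m_l}]$ is mapped to $t_l\{x^{(l)}_j:=s'_j\}_{1\le j\le m_l}$ where $s'_j=s_j\{\mathsf{m}_i:=(\vec{x}_i)t_i\}_{1\le i\le k}$. The category $\mathbb{M}$ (second-order theory of equality). Objects are finite sequences $(m_1,\dots,m_k)\in\mathbb{N}^*$. A morphism $(m_1,\dots,m_k)\to(n_1,\dots,n_l)$ is an $l$-tuple $\langle \mathsf{m}_1:[m_1],\dots,\mathsf{m}_k:[m_k]\triangleright x_1,\dots,x_{n_i}\vdash t_i\rangle_{1\le i\le l}$ of elementary terms (names of variables and metavariables in contexts are immaterial). The identity on $(m_1,\dots,m_k)$ is $\langle\mathsf{m}_i[x_1,\dots,x_{m_i}]\rangle_{1\le i\le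 k}$. The composite of $\langle s_p\rangle_{1\le p\le j}:(l_1,\dots,l_i)\to(m_1,\dots,m_j)$ followed by $\langle t_q\rangle_{1\le q\le k}:(m_1,\dots,m_j)\to(n_1,\dots,n_k)$ is $\langle t_q\{\mathsf{m}_p:=(x_1,\dots,x_{m_p})s_p\}_{1\le p\le j}\rangle_{1\le q\le k}$. $\mathbb{M}$ has strict finite products: the terminal object is $()$, and the product is concatenation of sequences, with projections $\langle\mathsf{m}_i[x_1,\dots,x_{m_i}]\rangle:(m_1,\dots,m_k)\to(m_i)$. The object $(0)$ is exponentiable in $\mathbb{M}$, with $(0)\Rightarrow(m_1,\dots,m_k)=(m_1+1,\dots,m_k+1)$ and evaluation map $(m_1+1,\dots,m_k+1)\times(0)\to(m_1,\dots,m_k)$ given by $\langle\mathsf{m}_1:[m_1+1],\dots,\mathsf{m}_k:[m_k+1],\mathsf{n}:[0]\triangleright x_1,\dots,x_{m_i}\vdash\mathsf{m}_i[x_1,\dots,x_{m_i},\mathsf{n}[]]\rangle_{1\le i\le k}$. *)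

theory Defs
  imports Main
begin

section \<open>Cartesian categories\<close>

record ('o, 'a) cat =
  Obj :: "'o set"
  Arr :: "'a set"
  Dom :: "'a \<Rightarrow> 'o"
  Cod :: "'a \<Rightarrow> 'o"
  Idt :: "'o \<Rightarrow> 'a"
  Comp :: "'a \<Rightarrow> 'a \<Rightarrow> 'a"  (infixr "\<cdot>\<index>" 70)

definition hom :: "('o, 'a, 'z) cat_scheme \<Rightarrow> 'o \<Rightarrow> 'o \<Rightarrow> 'a set" where
  "hom C a b = {f \<in> Arr C. Dom C f = a \<and> Cod C f = b}"

text \<open>The operations are only specified on objects, arrows and composable pairs of arrows;
  composition is written in applicative order.\<close>

locale category =
  fixes C :: "('o, 'a, 'z) cat_scheme"  (structure)
  assumes dom_obj: "f \<in> Arr C \<Longrightarrow> Dom C f \<in> Obj C"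
    and cod_obj: "f \<in> Arr C \<Longrightarrow> Cod C f \<in> Obj C"
    and idt_hom: "a \<in> Obj C \<Longrightarrow> Idt C a \<in> hom C a a"
    and comp_hom: "f \<in> hom C a b \<Longrightarrow> g \<in> hom C b c \<Longrightarrow> g \<cdot> f \<in> hom C a c"
    and comp_idt: "f \<in> hom C a b \<Longrightarrow> f \<cdot> Idt C a = f"
    and idt_comp: "f \<in> hom C a b \<Longrightarrow> Idt C b \<cdot> f = f"
    and comp_assoc: "f \<in> hom C a b \<Longrightarrow> g \<in> hom C b c \<Longrightarrow> h \<in> hom C c d \<Longrightarrow>
      (h \<cdot> g) \<cdot> f = h \<cdot> (g \<cdot> f)"

definition inverse_arrows :: "('o, 'a, 'z) cat_scheme \<Rightarrow> 'a \<Rightarrow> 'a \<Rightarrow> bool" where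
  "inverse_arrows C f g \<longleftrightarrow>
     f \<in> Arr C \<and> g \<in> hom C (Cod C f) (Dom C f) \<and>
     g \<cdot>\<^bsub>C\<^esub> f = Idt C (Dom C f) \<and> f \<cdot>\<^bsub>C\<^esub> g = Idt C (Cod C f)"

definition iso :: "('o, 'a, 'z) cat_scheme \<Rightarrow> 'a \<Rightarrow> bool" where
  "iso C f \<longleftrightarrow> (\<exists>g. inverse_arrows C f g)"

definition inv_arr :: "('o, 'a, 'z) cat_scheme \<Rightarrow> 'a \<Rightarrow> 'a" where
  "inv_arr C f = (THE g. inverse_arrows C f g)"

definition isomorphic :: "('o, 'a, 'z) cat_scheme \<Rightarrow> 'o \<Rightarrow> 'o \<Rightarrow> bool" where
  "isomorphic C a b \<longleftrightarrow> (\<exists>f \<in> hom C a b. iso C f)"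

text \<open>Chosen finite products are given by a chosen terminal object and chosen binary products.\<close>

record ('o, 'a) ccat = "('o, 'a) cat" +
  One :: 'o
  Prd :: "'o \<Rightarrow> 'o \<Rightarrow> 'o"
  Fst :: "'o \<Rightarrow> 'o \<Rightarrow> 'a"
  Snd :: "'o \<Rightarrow> 'o \<Rightarrow> 'a"

locale cartesian_category = category C
  for C :: "('o, 'a, 'z) ccat_scheme"  (structure) +
  assumes one_obj: "One C \<in> Obj C"
    and one_universal: "a \<in> Obj C \<Longrightarrow> \<exists>!f. f \<in> hom C a (One C)"
    and prd_obj: "a \<in> Obj C \<Longrightarrow> b \<in> Obj C \<Longrightarrow> Prd C a b \<in> Obj C"
    and fst_hom: "a \<in> Obj C \<Longrightarrow> b \<in> Obj C \<Longrightarrow> Fst C a b \<in> hom C (Prd C a b) a"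
    and snd_hom: "a \<in> Obj C \<Longrightarrow> b \<in> Obj C \<Longrightarrow> Snd C a b \<in> hom C (Prd C a b) b"
    and prd_universal: "f \<in> hom C x a \<Longrightarrow> g \<in> hom C x b \<Longrightarrow>
      \<exists>!h. h \<in> hom C x (Prd C a b) \<and> Fst C a b \<cdot> h = f \<and> Snd C a b \<cdot> h = g"

definition bang :: "('o, 'a, 'z) ccat_scheme \<Rightarrow> 'o \<Rightarrow> 'a" where
  "bang C a = (THE f. f \<in> hom C a (One C))"

definition pairing :: "('o, 'a, 'z) ccat_scheme \<Rightarrow> 'a \<Rightarrow> 'a \<Rightarrow> 'a" where
  "pairing C f g =
     (THE h. h \<in> hom C (Dom C f) (Prd C (Cod C f) (Cod C g)) \<and>
        Fst C (Cod C f) (Cod C g) \<cdot>\<^bsub>C\<^esub> h = f \<and>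
        Snd C (Cod C f) (Cod C g) \<cdot>\<^bsub>C\<^esub> h = g)"

definition prd_arr :: "('o, 'a, 'z) ccat_scheme \<Rightarrow> 'a \<Rightarrow> 'a \<Rightarrow> 'a" where
  "prd_arr C f g =
     pairing C (f \<cdot>\<^bsub>C\<^esub> Fst C (Dom C f) (Dom C g)) (g \<cdot>\<^bsub>C\<^esub> Snd C (Dom C f) (Dom C g))"


section \<open>Exponentiable objects\<close>

definition is_mate ::
  "('o, 'a, 'z) ccat_scheme \<Rightarrow> 'o \<Rightarrow> 'o \<Rightarrow> 'a \<Rightarrow> 'o \<Rightarrow> 'a \<Rightarrow> 'a \<Rightarrow> bool" where
  "is_mate C c e ev a f g \<longleftrightarrow> g \<in> hom C a e \<and> ev \<cdot>\<^bsub>C\<^esub> prd_arr C g (Idt C c) = f"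

definition is_exponential ::
  "('o, 'a, 'z) ccat_scheme \<Rightarrow> 'o \<Rightarrow> 'o \<Rightarrow> 'o \<Rightarrow> 'a \<Rightarrow> bool" where
  "is_exponential C c b e ev \<longleftrightarrow>
     e \<in> Obj C \<and> ev \<in> hom C (Prd C e c) b \<and>
     (\<forall>a \<in> Obj C. \<forall>f \<in> hom C (Prd C a c) b. \<exists>!g. is_mate C c e ev a f g)"

definition mate ::
  "('o, 'a, 'z) ccat_scheme \<Rightarrow> 'o \<Rightarrow> 'o \<Rightarrow> 'a \<Rightarrow> 'o \<Rightarrow> 'a \<Rightarrow> 'a" where
  "mate C c e ev a f = (THE g. is_mate C c e ev a f g)"

definition exponentiable :: "('o, 'a, 'z) ccat_scheme \<Rightarrow> 'o \<Rightarrow> bool" where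
  "exponentiable C c \<longleftrightarrow>
     c \<in> Obj C \<and> (\<forall>b \<in> Obj C. \<exists>e ev. is_exponential C c b e ev)"


section \<open>Cartesian functors\<close>

record ('o, 'a, 'p, 'b) ftor =
  FO :: "'o \<Rightarrow> 'p"
  FA :: "'a \<Rightarrow> 'b"

definition is_functor ::
  "('o, 'a, 'y) cat_scheme \<Rightarrow> ('p, 'b, 'z) cat_scheme \<Rightarrow> ('o, 'a, 'p, 'b) ftor \<Rightarrow> bool" where
  "is_functor C D F \<longleftrightarrow>
     (\<forall>a \<in> Obj C. FO F a \<in> Obj D) \<and>
     (\<forall>f \<in> Arr C. FA F f \<in> hom D (FO F (Dom C f)) (FO F (Cod C f))) \<and>
     (\<forall>a \<in> Obj C. FA F (Idt C a) = Idt D (FO F a)) \<and>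
     (\<forall>f \<in> Arr C. \<forall>g \<in> Arr C. Dom C g = Cod C f \<longrightarrow>
        FA F (g \<cdot>\<^bsub>C\<^esub> f) = FA F g \<cdot>\<^bsub>D\<^esub> FA F f)"

definition prd_comparison ::
  "('o, 'a, 'y) ccat_scheme \<Rightarrow> ('p, 'b, 'z) ccat_scheme \<Rightarrow> ('o, 'a, 'p, 'b) ftor \<Rightarrow>
    'o \<Rightarrow> 'o \<Rightarrow> 'b" where
  "prd_comparison C D F a b = pairing D (FA F (Fst C a b)) (FA F (Snd C a b))"

definition cartesian_functor ::
  "('o, 'a, 'y) ccat_scheme \<Rightarrow> ('p, 'b, 'z) ccat_scheme \<Rightarrow> ('o, 'a, 'p, 'b) ftor \<Rightarrow> bool" where
  "cartesian_functor C D F \<longleftrightarrow>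
     is_functor C D F \<and>
     iso D (bang D (FO F (One C))) \<and>
     (\<forall>a \<in> Obj C. \<forall>b \<in> Obj C. iso D (prd_comparison C D F a b))"

text \<open>The source comes with chosen exponentials \<open>E b\<close> and evaluations \<open>ev b\<close> for the object \<open>c\<close>.
  In the target only exponentiability of \<open>F c\<close> is required, and the comparison arrow is
  required to be invertible for every exponential of \<open>F b\<close> by \<open>F c\<close>.\<close>

definition preserves_exponentiable ::
  "('o, 'a, 'y) ccat_scheme \<Rightarrow> 'o \<Rightarrow> ('o \<Rightarrow> 'o) \<Rightarrow> ('o \<Rightarrow> 'a) \<Rightarrow>
    ('p, 'b, 'z) ccat_scheme \<Rightarrow> ('o, 'a, 'p, 'b) ftor \<Rightarrow> bool" where
  "preserves_exponentiable C c E ev D F \<longleftrightarrow>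
     exponentiable D (FO F c) \<and>
     (\<forall>b \<in> Obj C. \<forall>e' ev'. is_exponential D (FO F c) (FO F b) e' ev' \<longrightarrow>
        iso D (mate D (FO F c) e' ev' (FO F (E b))
          (FA F (ev b) \<cdot>\<^bsub>D\<^esub> inv_arr D (prd_comparison C D F (E b) c))))"

definition naturally_isomorphic ::
  "('o, 'a, 'y) cat_scheme \<Rightarrow> ('p, 'b, 'z) cat_scheme \<Rightarrow>
    ('o, 'a, 'p, 'b) ftor \<Rightarrow> ('o, 'a, 'p, 'b) ftor \<Rightarrow> bool" where
  "naturally_isomorphic C D F G \<longleftrightarrow>
     (\<exists>\<tau>. (\<forall>a \<in> Obj C. \<tau> a \<in> hom D (FO F a) (FO G a) \<and> iso D (\<tau> a)) \<and>
       (\<forall>f \<in> Arr C. FA G f \<cdot>\<^bsub>D\<^esub> \<tau> (Dom C f) = \<tau> (Cod C f) \<cdot>\<^bsub>D\<^esub> FA F f))"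


section \<open>Elementary second-order terms\<close>

text \<open>Names in contexts are immaterial, so variables and metavariables are identified with their
  positions, counted from 0: a context is a list \<open>\<Theta>\<close> of meta-arities together with a number \<open>n\<close>
  of variables, \<open>Var i\<close> is the variable written $x_{i+1}$ on paper, and \<open>Meta i ts\<close> is
  $m_{i+1}[ts]$.\<close>

datatype trm = Var nat | Meta nat "trm list"

inductive elementary :: "nat list \<Rightarrow> nat \<Rightarrow> trm \<Rightarrow> bool" for \<Theta> :: "nat list" and n :: nat where
  var: "i < n \<Longrightarrow> elementary \<Theta> n (Var i)"
| meta: "i < length \<Theta> \<Longrightarrow> length ts = \<Theta> ! i \<Longrightarrow> (\<forall>t \<in> set ts. elementary \<Theta> n t) \<Longrightarrow>
    elementary \<Theta> n (Meta i ts)"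

text \<open>Simultaneous substitution for the first \<open>length us\<close> variables. The context of the term is
  read as \<open>us\<close>-many variables followed by those of the target context \<open>\<Gamma>\<close>; the latter are kept
  and therefore renumbered. No variables are bound inside elementary terms.\<close>

primrec subst :: "trm list \<Rightarrow> trm \<Rightarrow> trm" where
  "subst us (Var i) = (if i < length us then us ! i else Var (i - length us))"
| "subst us (Meta i ts) = Meta i (map (subst us) ts)"

text \<open>In \<open>msubst ss t\<close> the \<open>i\<close>-th metavariable is replaced by the abstraction
  whose body is \<open>ss ! i\<close>, the first (arity many) variables of the body being the abstracted ones.\<close>

primrec msubst :: "trm list \<Rightarrow> trm \<Rightarrow> trm" where
  "msubst ss (Var i) = Var i"
| "msubst ss (Meta i ts) = subst (map (msubst ss) ts) (ss ! i)"


section \<open>The second-order theory of equality\<close>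

text \<open>The same tuple of terms may be a morphism between different objects, so an arrow records
  its domain and codomain: \<open>(ms, ts, ns)\<close>.\<close>

type_synonym marr = "nat list \<times> trm list \<times> nat list"

definition gen :: "nat \<Rightarrow> nat \<Rightarrow> trm" where
  "gen i m = Meta i (map Var [0..<m])"

definition MM :: "(nat list, marr) ccat" where
  "MM = \<lparr>
     Obj = UNIV,
     Arr = {(ms, ts, ns). length ts = length ns \<and>
              (\<forall>i < length ns. elementary ms (ns ! i) (ts ! i))},
     Dom = (\<lambda>(ms, ts, ns). ms),
     Cod = (\<lambda>(ms, ts, ns). ns),
     Idt = (\<lambda>ms. (ms, map (\<lambda>i. gen i (ms ! i)) [0..<length ms], ms)),
     Comp = (\<lambda>(_, ts, ns) (ls, ss, _). (ls, map (msubst ss) ts, ns)),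
     One = [],
     Prd = (\<lambda>ms ns. ms @ ns),
     Fst = (\<lambda>ms ns. (ms @ ns, map (\<lambda>i. gen i (ms ! i)) [0..<length ms], ms)),
     Snd = (\<lambda>ms ns. (ms @ ns, map (\<lambda>i. gen (length ms + i) (ns ! i)) [0..<length ns], ns)) \<rparr>"

definition MM_exp :: "nat list \<Rightarrow> nat list" where
  "MM_exp ms = map Suc ms"

definition MM_ev :: "nat list \<Rightarrow> marr" where
  "MM_ev ms =
     (MM_exp ms @ [0],
      map (\<lambda>i. Meta i (map Var [0..<ms ! i] @ [Meta (length ms) []])) [0..<length ms],
      ms)"

end

theory Submission
  imports Defs
begin

text \<open>
  The theory \<open>MM\<close> is built from nothing but a generic object \<open>[0]\<close> and its exponentials: an object
  \<open>[m]\<close> is the \<open>m\<close>-fold exponential of \<open>[0]\<close> by itself, every object is a finite product of such,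
  and every term is obtained from projections by tupling, evaluation and currying. Initiality says
  that these data can be interpreted in any cartesian category with an exponentiable object \<open>D\<close>,
  and in one way only up to isomorphism.

  Existence. Put \<open>E 0 = D\<close> and let \<open>E (Suc m)\<close> be an exponential of \<open>E m\<close> by \<open>D\<close>; interpret
  \<open>[m\<^sub>1, \<dots>, m\<^sub>k]\<close> by the product of the \<open>E m\<^sub>i\<close>. Interpreting terms in context by arrows out of a
  product of contexts would require transporting everything along isomorphisms between products.
  Generalised elements avoid this: at a stage \<open>x\<close>, a metavariable of arity \<open>m\<close> denotes an arrow
  \<open>x \<rightarrow> E m\<close>, a variable denotes an arrow \<open>x \<rightarrow> D\<close>, and a term then evaluates to an arrow
  \<open>x \<rightarrow> D\<close> by iterated evaluation (\<open>app\<close>, \<open>eval\<close>). A family of maps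
  \<open>Hom(x, a) \<times> Hom(x, D)\<^sup>m \<rightarrow> Hom(x, D)\<close> natural in \<open>x\<close> is the same as an arrow \<open>a \<rightarrow> E m\<close>
  (\<open>app_abstraction\<close>, \<open>app_ext\<close>). So a term with \<open>m\<close> variables denotes a unique arrow into \<open>E m\<close>,
  and every equation between arrows that are interpretations can be tested by evaluating. In
  particular functoriality reduces to the lemma that evaluation turns metasubstitution into change
  of environment (\<open>eval_msubst\<close>).

  Uniqueness. A functor \<open>F\<close> as in the theorem makes \<open>F [Suc n]\<close> an exponential of \<open>F [n]\<close> by
  \<open>F [0]\<close>. Given two such functors \<open>I\<close> and \<open>J\<close>, an isomorphism \<open>I [0] \<cong> J [0]\<close> therefore extends by
  recursion to isomorphisms \<open>\<theta> n : I [n] \<cong> J [n]\<close> compatible with evaluation, and then to all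
  objects, because \<open>I\<close> and \<open>J\<close> preserve products. By construction the resulting transformation is
  natural at projections, and naturality is inherited under tupling, evaluation and
  currying. These operations generate all terms (\<open>elementary_generated\<close>), so it is natural.
\<close>

section \<open>Arrows, products and isomorphisms\<close>

text \<open>Unfolding hom-sets into \<open>Arr\<close>, \<open>Dom\<close> and \<open>Cod\<close> lets the simplifier discharge typing conditions by
  computing domains and codomains, where \<open>f \<in> hom C a b\<close> as a condition would leave \<open>a\<close> and \<open>b\<close> to be
  guessed.\<close>

lemma in_hom [simp]: "f \<in> hom C a b \<longleftrightarrow> f \<in> Arr C \<and> Dom C f = a \<and> Cod C f = b"
  by (simp add: hom_def)

context category
begin

lemma comp_arr [simp]:
  assumes "f \<in> Arr C" "g \<in> Arr C" "Dom C g = Cod C f"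
  shows "g \<cdot> f \<in> Arr C" "Dom C (g \<cdot> f) = Dom C f" "Cod C (g \<cdot> f) = Cod C g"
  using comp_hom[of f "Dom C f" "Cod C f" g "Cod C g"] assms by auto

lemma assoc [simp]:
  assumes "f \<in> Arr C" "g \<in> Arr C" "h \<in> Arr C" "Dom C g = Cod C f" "Dom C h = Cod C g"
  shows "(h \<cdot> g) \<cdot> f = h \<cdot> (g \<cdot> f)"
  using comp_assoc[of f "Dom C f" "Cod C f" g "Cod C g" h "Cod C h"] assms by auto

lemma idt_arr [simp]:
  assumes "a \<in> Obj C"
  shows "Idt C a \<in> Arr C" "Dom C (Idt C a) = a" "Cod C (Idt C a) = a"
  using idt_hom[OF assms] by auto

lemma comp_idt' [simp]: "f \<in> Arr C \<Longrightarrow> Dom C f = a \<Longrightarrow> f \<cdot> Idt C a = f"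
  using comp_idt[of f a "Cod C f"] by auto

lemma idt_comp' [simp]: "f \<in> Arr C \<Longrightarrow> Cod C f = a \<Longrightarrow> Idt C a \<cdot> f = f"
  using idt_comp[of f "Dom C f" a] by auto

declare dom_obj [simp] cod_obj [simp]

lemma isoI:
  assumes "f \<in> hom C a b" "g \<in> hom C b a" "g \<cdot> f = Idt C a" "f \<cdot> g = Idt C b"
  shows "iso C f"
  using assms by (auto simp: iso_def inverse_arrows_def)

lemma inverse_arrows_unique:
  assumes "inverse_arrows C f g" "inverse_arrows C f h"
  shows "g = h"
proof -
  have "g = g \<cdot> (f \<cdot> h)"
    using assms by (auto simp: inverse_arrows_def)
  also have "\<dots> = (g \<cdot> f) \<cdot> h"
    using assms unfolding inverse_arrows_def in_hom by (subst assoc) auto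
  also have "\<dots> = h"
    using assms by (auto simp: inverse_arrows_def)
  finally show ?thesis .
qed

lemma inv_arr_inverse:
  assumes "iso C f"
  shows "inverse_arrows C f (inv_arr C f)"
  using assms inverse_arrows_unique unfolding iso_def inv_arr_def by (metis theI)

lemma inv_arr_simps [simp]:
  assumes "iso C f"
  shows "inv_arr C f \<in> Arr C" "Dom C (inv_arr C f) = Cod C f" "Cod C (inv_arr C f) = Dom C f"
    "inv_arr C f \<cdot> f = Idt C (Dom C f)" "f \<cdot> inv_arr C f = Idt C (Cod C f)"
  using inv_arr_inverse[OF assms] by (auto simp: inverse_arrows_def)

lemma iso_arr: "iso C f \<Longrightarrow> f \<in> Arr C"
  by (auto simp: iso_def inverse_arrows_def)

lemma inv_arr_cancel [simp]:
  assumes "iso C f" "g \<in> Arr C"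
  shows "Cod C g = Dom C f \<Longrightarrow> inv_arr C f \<cdot> (f \<cdot> g) = g"
    "Cod C g = Cod C f \<Longrightarrow> f \<cdot> (inv_arr C f \<cdot> g) = g"
  using assms iso_arr[OF assms(1)] by (simp_all flip: assoc)

lemma iso_inv_arr: "iso C f \<Longrightarrow> iso C (inv_arr C f)"
  by (rule isoI[of _ "Cod C f" "Dom C f" f]) (simp_all add: iso_arr)

lemma iso_comp:
  assumes "iso C f" "iso C g" "Dom C g = Cod C f"
  shows "iso C (g \<cdot> f)"
  by (rule isoI[of _ "Dom C f" "Cod C g" "inv_arr C f \<cdot> inv_arr C g"])
    (use assms iso_arr in simp_all)

end

context cartesian_category
begin

declare one_obj [simp] prd_obj [simp]

lemma fst_snd_arr [simp]:
  assumes "a \<in> Obj C" "b \<in> Obj C"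
  shows "Fst C a b \<in> Arr C" "Dom C (Fst C a b) = Prd C a b" "Cod C (Fst C a b) = a"
    "Snd C a b \<in> Arr C" "Dom C (Snd C a b) = Prd C a b" "Cod C (Snd C a b) = b"
  using fst_hom[OF assms] snd_hom[OF assms] by auto

lemma bang_arr [simp]:
  assumes "a \<in> Obj C"
  shows "bang C a \<in> Arr C" "Dom C (bang C a) = a" "Cod C (bang C a) = One C"
  using theI'[OF one_universal[OF assms]] by (auto simp: bang_def)

lemma one_ext:
  assumes "f \<in> hom C x (One C)" "g \<in> hom C x (One C)"
  shows "f = g"
  using one_universal[of x] assms by (metis in_hom dom_obj)

lemma pairing_props:
  assumes "f \<in> Arr C" "g \<in> Arr C" "Dom C f = Dom C g"
  shows "pairing C f g \<in> hom C (Dom C f) (Prd C (Cod C f) (Cod C g)) \<and>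
    Fst C (Cod C f) (Cod C g) \<cdot> pairing C f g = f \<and>
    Snd C (Cod C f) (Cod C g) \<cdot> pairing C f g = g"
  unfolding pairing_def
  by (rule theI', rule prd_universal) (use assms in auto)

lemma pairing_arr [simp]:
  assumes "f \<in> Arr C" "g \<in> Arr C" "Dom C f = Dom C g"
  shows "pairing C f g \<in> Arr C" "Dom C (pairing C f g) = Dom C g"
    "Cod C (pairing C f g) = Prd C (Cod C f) (Cod C g)"
  using pairing_props[OF assms] assms by auto

lemma proj_pairing [simp]:
  assumes "f \<in> Arr C" "g \<in> Arr C" "Dom C f = Dom C g" "Cod C f = a" "Cod C g = b"
  shows "Fst C a b \<cdot> pairing C f g = f" "Snd C a b \<cdot> pairing C f g = g"
  using pairing_props[OF assms(1-3)] assms by auto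

lemma pairing_ext:
  assumes "h \<in> hom C x (Prd C a b)" "k \<in> hom C x (Prd C a b)" "a \<in> Obj C" "b \<in> Obj C"
    and "Fst C a b \<cdot> h = Fst C a b \<cdot> k" "Snd C a b \<cdot> h = Snd C a b \<cdot> k"
  shows "h = k"
proof -
  have "Fst C a b \<cdot> h \<in> hom C x a" "Snd C a b \<cdot> h \<in> hom C x b"
    using assms by auto
  from prd_universal[OF this] show ?thesis
    using assms by metis
qed

lemma pairing_comp [simp]:
  assumes "f \<in> Arr C" "g \<in> Arr C" "Dom C f = Dom C g" "h \<in> Arr C" "Cod C h = Dom C g"
  shows "pairing C f g \<cdot> h = pairing C (f \<cdot> h) (g \<cdot> h)"
  by (rule pairing_ext[of _ "Dom C h" "Cod C f" "Cod C g"])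
    (use assms in \<open>auto simp flip: assoc\<close>)

lemma pairing_proj [simp]:
  assumes "a \<in> Obj C" "b \<in> Obj C"
  shows "pairing C (Fst C a b) (Snd C a b) = Idt C (Prd C a b)"
  by (rule pairing_ext[of _ "Prd C a b" a b]) (use assms in auto)

lemma pairing_inject:
  assumes "pairing C f g = pairing C f' g'" "f \<in> hom C x a" "f' \<in> hom C x a"
    "g \<in> hom C x b" "g' \<in> hom C x b"
  shows "f = f'" "g = g'"
proof -
  have "f = Fst C a b \<cdot> pairing C f g" "g = Snd C a b \<cdot> pairing C f g"
    using assms(2-) by simp_all
  then show "f = f'" "g = g'"
    unfolding assms(1) using assms(2-) by simp_all
qed

text \<open>If the pairing of \<open>p\<close> and \<open>q\<close> is invertible, then \<open>z\<close> with \<open>p\<close> and \<open>q\<close> is itself a product of \<open>a\<close> and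
  \<open>b\<close>. A functor with invertible product comparisons is used only through this lemma and the next.\<close>

lemma iso_pairing_factor:
  assumes p: "p \<in> hom C z a" and q: "q \<in> hom C z b" and i: "iso C (pairing C p q)"
    and f: "f \<in> hom C x a" and g: "g \<in> hom C x b"
  shows "inv_arr C (pairing C p q) \<cdot> pairing C f g \<in> hom C x z"
    and "p \<cdot> (inv_arr C (pairing C p q) \<cdot> pairing C f g) = f"
    and "q \<cdot> (inv_arr C (pairing C p q) \<cdot> pairing C f g) = g"
proof -
  define k where "k = inv_arr C (pairing C p q) \<cdot> pairing C f g"
  have k: "k \<in> hom C x z"
    using p q i f g by (simp add: k_def)
  have "pairing C p q \<cdot> k = pairing C f g"
    using p q i f g by (simp add: k_def del: pairing_comp)
  then have eq: "pairing C (p \<cdot> k) (q \<cdot> k) = pairing C f g"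
    using p q k by simp
  have pk: "p \<cdot> k \<in> hom C x a" "q \<cdot> k \<in> hom C x b"
    using p q k by simp_all
  show "inv_arr C (pairing C p q) \<cdot> pairing C f g \<in> hom C x z"
    "p \<cdot> (inv_arr C (pairing C p q) \<cdot> pairing C f g) = f"
    "q \<cdot> (inv_arr C (pairing C p q) \<cdot> pairing C f g) = g"
    using k pairing_inject[OF eq pk(1) f pk(2) g] unfolding k_def by blast+
qed

lemma iso_pairing_ext:
  assumes p: "p \<in> hom C z a" and q: "q \<in> hom C z b" and i: "iso C (pairing C p q)"
    and h: "h \<in> hom C x z" and k: "k \<in> hom C x z"
    and eq: "p \<cdot> h = p \<cdot> k" "q \<cdot> h = q \<cdot> k"
  shows "h = k"
proof -
  have "pairing C p q \<cdot> h = pairing C p q \<cdot> k"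
    using p q h k eq by simp
  then have "inv_arr C (pairing C p q) \<cdot> (pairing C p q \<cdot> h) =
      inv_arr C (pairing C p q) \<cdot> (pairing C p q \<cdot> k)"
    by simp
  moreover have "inv_arr C (pairing C p q) \<cdot> (pairing C p q \<cdot> l) = l" if "l \<in> hom C x z" for l
    using i that p q by (intro inv_arr_cancel(1)) simp_all
  ultimately show ?thesis
    using h k by simp
qed

lemma prd_arr_arr [simp]:
  assumes "f \<in> Arr C" "g \<in> Arr C"
  shows "prd_arr C f g \<in> Arr C" "Dom C (prd_arr C f g) = Prd C (Dom C f) (Dom C g)"
    "Cod C (prd_arr C f g) = Prd C (Cod C f) (Cod C g)"
  using assms by (simp_all add: prd_arr_def)

lemma prd_arr_pairing [simp]:
  assumes "f \<in> Arr C" "g \<in> Arr C" "h \<in> Arr C" "k \<in> Arr C"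
    "Dom C h = Dom C k" "Dom C f = Cod C h" "Dom C g = Cod C k"
  shows "prd_arr C f g \<cdot> pairing C h k = pairing C (f \<cdot> h) (g \<cdot> k)"
  using assms by (simp add: prd_arr_def)


section \<open>Exponentials through generalised elements\<close>

lemma exp_arr:
  assumes "is_exponential C c b e ev"
  shows "e \<in> Obj C" "ev \<in> Arr C" "Dom C ev = Prd C e c" "Cod C ev = b"
  using assms by (auto simp: is_exponential_def)

text \<open>The defining equation of a mate is an equation on the generic element of \<open>Prd C a c\<close>, given by the
  two projections; precomposing with a pairing yields it at all pairs of generalised elements. In
  this form products of arrows disappear, and an exponential is handled like a function space with
  \<open>ev\<close> as application: \<open>exp_curry\<close> is comprehension and \<open>exp_ext\<close> is extensionality.\<close>

lemma mate_generalised: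
  assumes "c \<in> Obj C" "e \<in> Obj C" "ev \<in> hom C (Prd C e c) b" "a \<in> Obj C" "f \<in> hom C (Prd C a c) b"
  shows "is_mate C c e ev a f g \<longleftrightarrow> g \<in> hom C a e \<and>
    (\<forall>x h k. h \<in> hom C x a \<longrightarrow> k \<in> hom C x c \<longrightarrow> ev \<cdot> pairing C (g \<cdot> h) k = f \<cdot> pairing C h k)"
    (is "?L \<longleftrightarrow> ?R")
proof
  assume L: ?L
  have "ev \<cdot> pairing C (g \<cdot> h) k = f \<cdot> pairing C h k" if "h \<in> hom C x a" "k \<in> hom C x c" for x h k
  proof -
    have "f \<cdot> pairing C h k = (ev \<cdot> prd_arr C g (Idt C c)) \<cdot> pairing C h k"
      using L by (simp add: is_mate_def)
    also have "\<dots> = ev \<cdot> pairing C (g \<cdot> h) k"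
    proof -
      have "g \<in> hom C a e" using L by (simp add: is_mate_def)
      then show ?thesis using that assms by simp
    qed
    finally show ?thesis ..
  qed
  with L show ?R by (simp add: is_mate_def)
next
  assume R: ?R
  have "ev \<cdot> prd_arr C g (Idt C c) = ev \<cdot> pairing C (g \<cdot> Fst C a c) (Snd C a c)"
    using R assms by (simp add: prd_arr_def)
  also have "\<dots> = f \<cdot> pairing C (Fst C a c) (Snd C a c)"
    using R assms by (metis fst_hom snd_hom)
  also have "\<dots> = f"
    using assms by simp
  finally show ?L using R by (simp add: is_mate_def)
qed

lemma exp_curry:
  assumes "is_exponential C c b e ev" "c \<in> Obj C" "a \<in> Obj C" "f \<in> hom C (Prd C a c) b"
  obtains g where "g \<in> hom C a e"
    "\<And>x h k. h \<in> hom C x a \<Longrightarrow> k \<in> hom C x c \<Longrightarrow> ev \<cdot> pairing C (g \<cdot> h) k = f \<cdot> pairing C h k"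
proof -
  from assms obtain g where "is_mate C c e ev a f g"
    unfolding is_exponential_def by blast
  then show ?thesis
    using that mate_generalised[of c e ev b a f g] assms unfolding is_exponential_def by blast
qed

lemma exp_ext:
  assumes "is_exponential C c b e ev" "c \<in> Obj C" "g \<in> hom C a e" "g' \<in> hom C a e"
    and "\<And>x h k. h \<in> hom C x a \<Longrightarrow> k \<in> hom C x c \<Longrightarrow>
      ev \<cdot> pairing C (g \<cdot> h) k = ev \<cdot> pairing C (g' \<cdot> h) k"
  shows "g = g'"
proof -
  note ex = exp_arr[OF assms(1)]
  have a: "a \<in> Obj C" using assms by auto
  have "ev \<cdot> prd_arr C g (Idt C c) = ev \<cdot> prd_arr C g' (Idt C c)"
    using assms(5)[of "Fst C a c" "Prd C a c" "Snd C a c"] assms a by (simp add: prd_arr_def)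
  then have "is_mate C c e ev a (ev \<cdot> prd_arr C g (Idt C c)) g"
    "is_mate C c e ev a (ev \<cdot> prd_arr C g (Idt C c)) g'"
    using assms by (auto simp: is_mate_def)
  moreover have "ev \<cdot> prd_arr C g (Idt C c) \<in> hom C (Prd C a c) b"
    using assms ex by auto
  ultimately show ?thesis
    using assms(1) a unfolding is_exponential_def by blast
qed

lemma is_exponentialI:
  assumes "c \<in> Obj C" "e \<in> Obj C" "ev \<in> hom C (Prd C e c) b"
    and ex: "\<And>a f. a \<in> Obj C \<Longrightarrow> f \<in> hom C (Prd C a c) b \<Longrightarrow> \<exists>g \<in> hom C a e.
      \<forall>x h k. h \<in> hom C x a \<longrightarrow> k \<in> hom C x c \<longrightarrow> ev \<cdot> pairing C (g \<cdot> h) k = f \<cdot> pairing C h k"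
    and ext: "\<And>a g g'. g \<in> hom C a e \<Longrightarrow> g' \<in> hom C a e \<Longrightarrow>
      (\<And>x h k. h \<in> hom C x a \<Longrightarrow> k \<in> hom C x c \<Longrightarrow>
        ev \<cdot> pairing C (g \<cdot> h) k = ev \<cdot> pairing C (g' \<cdot> h) k) \<Longrightarrow> g = g'"
  shows "is_exponential C c b e ev"
proof -
  have "\<exists>!g. is_mate C c e ev a f g" if "a \<in> Obj C" "f \<in> hom C (Prd C a c) b" for a f
    unfolding mate_generalised[OF assms(1-3) that]
    using ex[OF that] by (metis (no_types, lifting) ext)
  then show ?thesis
    using assms unfolding is_exponential_def by blast
qed

text \<open>Functoriality of exponentials: \<open>\<epsilon>\<close> is the map \<open>h \<mapsto> \<beta> \<circ> h \<circ> \<gamma>\<close> of function spaces.\<close>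

lemma exp_map:
  assumes "is_exponential C c b e ev" "is_exponential C c' b' e' ev'" "c \<in> Obj C"
    and "\<beta> \<in> hom C b b'" "\<gamma> \<in> hom C c' c"
  obtains \<epsilon> where "\<epsilon> \<in> hom C e e'"
    "\<And>x h k. h \<in> hom C x e \<Longrightarrow> k \<in> hom C x c' \<Longrightarrow>
      ev' \<cdot> pairing C (\<epsilon> \<cdot> h) k = \<beta> \<cdot> (ev \<cdot> pairing C h (\<gamma> \<cdot> k))"
proof -
  note ex = exp_arr[OF assms(1)] exp_arr[OF assms(2)]
  have c': "c' \<in> Obj C" using assms by auto
  let ?f = "\<beta> \<cdot> (ev \<cdot> pairing C (Fst C e c') (\<gamma> \<cdot> Snd C e c'))"
  have "?f \<in> hom C (Prd C e c') b'"
    using assms ex c' by simp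
  from exp_curry[OF assms(2) c' ex(1) this] obtain \<epsilon> where \<epsilon>: "\<epsilon> \<in> hom C e e'"
    "\<And>x h k. h \<in> hom C x e \<Longrightarrow> k \<in> hom C x c' \<Longrightarrow> ev' \<cdot> pairing C (\<epsilon> \<cdot> h) k = ?f \<cdot> pairing C h k"
    by blast
  show ?thesis
  proof (rule that[OF \<epsilon>(1)])
    fix x h k assume hk: "h \<in> hom C x e" "k \<in> hom C x c'"
    from \<epsilon>(2)[OF this] show "ev' \<cdot> pairing C (\<epsilon> \<cdot> h) k = \<beta> \<cdot> (ev \<cdot> pairing C h (\<gamma> \<cdot> k))"
      using assms ex c' hk by simp
  qed
qed

lemma exp_iso:
  assumes e: "is_exponential C c b e ev" and e': "is_exponential C c' b' e' ev'"
    and \<beta>: "iso C \<beta>" "\<beta> \<in> hom C b b'" and \<gamma>: "iso C \<gamma>" "\<gamma> \<in> hom C c c'"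
  obtains \<epsilon> where "iso C \<epsilon>" "\<epsilon> \<in> hom C e e'"
    "\<And>x h k. h \<in> hom C x e \<Longrightarrow> k \<in> hom C x c \<Longrightarrow>
      ev' \<cdot> pairing C (\<epsilon> \<cdot> h) (\<gamma> \<cdot> k) = \<beta> \<cdot> (ev \<cdot> pairing C h k)"
proof -
  note ex = exp_arr[OF e] exp_arr[OF e']
  have c: "c \<in> Obj C" "c' \<in> Obj C" using \<gamma> by auto
  have ib: "inv_arr C \<beta> \<in> hom C b' b" and ig: "inv_arr C \<gamma> \<in> hom C c' c"
    using \<beta> \<gamma> by auto
  obtain \<epsilon> where \<epsilon>: "\<epsilon> \<in> hom C e e'" "\<And>x h k. h \<in> hom C x e \<Longrightarrow> k \<in> hom C x c' \<Longrightarrow>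
      ev' \<cdot> pairing C (\<epsilon> \<cdot> h) k = \<beta> \<cdot> (ev \<cdot> pairing C h (inv_arr C \<gamma> \<cdot> k))"
    using exp_map[OF e e' c(1) \<beta>(2) ig] by blast
  obtain \<delta> where \<delta>: "\<delta> \<in> hom C e' e" "\<And>x h k. h \<in> hom C x e' \<Longrightarrow> k \<in> hom C x c \<Longrightarrow>
      ev \<cdot> pairing C (\<delta> \<cdot> h) k = inv_arr C \<beta> \<cdot> (ev' \<cdot> pairing C h (\<gamma> \<cdot> k))"
    using exp_map[OF e' e c(2) ib \<gamma>(2)] by blast
  have 1: "\<delta> \<cdot> \<epsilon> = Idt C e"
  proof (rule exp_ext[OF e c(1)])
    fix x h k assume hk: "h \<in> hom C x e" "k \<in> hom C x c"
    have "ev \<cdot> pairing C (\<delta> \<cdot> (\<epsilon> \<cdot> h)) k = inv_arr C \<beta> \<cdot> (ev' \<cdot> pairing C (\<epsilon> \<cdot> h) (\<gamma> \<cdot> k))"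
      by (rule \<delta>(2)) (use \<epsilon> hk in auto)
    also have "ev' \<cdot> pairing C (\<epsilon> \<cdot> h) (\<gamma> \<cdot> k) = \<beta> \<cdot> (ev \<cdot> pairing C h (inv_arr C \<gamma> \<cdot> (\<gamma> \<cdot> k)))"
      by (rule \<epsilon>(2)) (use \<gamma> hk in auto)
    also have "inv_arr C \<beta> \<cdot> \<dots> = ev \<cdot> pairing C h k"
      using \<beta> \<gamma> hk ex by simp
    finally show "ev \<cdot> pairing C ((\<delta> \<cdot> \<epsilon>) \<cdot> h) k = ev \<cdot> pairing C (Idt C e \<cdot> h) k"
      using \<delta> \<epsilon> hk by simp
  qed (use \<delta> \<epsilon> ex in auto)
  have 2: "\<epsilon> \<cdot> \<delta> = Idt C e'"
  proof (rule exp_ext[OF e' c(2)])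
    fix x h k assume hk: "h \<in> hom C x e'" "k \<in> hom C x c'"
    have "ev' \<cdot> pairing C (\<epsilon> \<cdot> (\<delta> \<cdot> h)) k = \<beta> \<cdot> (ev \<cdot> pairing C (\<delta> \<cdot> h) (inv_arr C \<gamma> \<cdot> k))"
      by (rule \<epsilon>(2)) (use \<delta> hk in auto)
    also have "ev \<cdot> pairing C (\<delta> \<cdot> h) (inv_arr C \<gamma> \<cdot> k) =
        inv_arr C \<beta> \<cdot> (ev' \<cdot> pairing C h (\<gamma> \<cdot> (inv_arr C \<gamma> \<cdot> k)))"
      by (rule \<delta>(2)) (use \<gamma> hk in auto)
    also have "\<beta> \<cdot> \<dots> = ev' \<cdot> pairing C h k"
      using \<beta> \<gamma> hk ex by simp
    finally show "ev' \<cdot> pairing C ((\<epsilon> \<cdot> \<delta>) \<cdot> h) k = ev' \<cdot> pairing C (Idt C e' \<cdot> h) k"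
      using \<delta> \<epsilon> hk by simp
  qed (use \<delta> \<epsilon> ex in auto)
  show ?thesis
  proof (rule that)
    show "iso C \<epsilon>" "\<epsilon> \<in> hom C e e'" using isoI[of \<epsilon> e e' \<delta>] 1 2 \<delta> \<epsilon> by auto
    fix x h k assume hk: "h \<in> hom C x e" "k \<in> hom C x c"
    have "ev' \<cdot> pairing C (\<epsilon> \<cdot> h) (\<gamma> \<cdot> k) = \<beta> \<cdot> (ev \<cdot> pairing C h (inv_arr C \<gamma> \<cdot> (\<gamma> \<cdot> k)))"
      by (rule \<epsilon>(2)) (use \<gamma> hk in auto)
    then show "ev' \<cdot> pairing C (\<epsilon> \<cdot> h) (\<gamma> \<cdot> k) = \<beta> \<cdot> (ev \<cdot> pairing C h k)"
      using \<gamma> hk by simp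
  qed
qed

text \<open>This lemma and the next show that invertibility of a comparison arrow, as it occurs in the
  definition of preservation, means that its domain is an exponential, too.\<close>

lemma mate_iso_if_exponential:
  assumes e: "is_exponential C c b e ev" and e': "is_exponential C c b e' ev'" and c: "c \<in> Obj C"
  shows "iso C (mate C c e' ev' e ev)"
proof -
  note ex = exp_arr[OF e] exp_arr[OF e']
  have "iso C (Idt C a)" if "a \<in> Obj C" for a
    using isoI[of "Idt C a" a a "Idt C a"] that by simp
  then obtain \<epsilon> where \<epsilon>: "iso C \<epsilon>" "\<epsilon> \<in> hom C e e'"
    "\<And>x h k. h \<in> hom C x e \<Longrightarrow> k \<in> hom C x c \<Longrightarrow>
      ev' \<cdot> pairing C (\<epsilon> \<cdot> h) (Idt C c \<cdot> k) = Idt C b \<cdot> (ev \<cdot> pairing C h k)"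
    using exp_iso[OF e e', of "Idt C b" "Idt C c"] c ex
    by (metis idt_hom cod_obj)
  have "is_mate C c e' ev' e ev \<epsilon>"
    using mate_generalised[of c e' ev' b e ev \<epsilon>] \<epsilon>(2,3) c ex by simp
  moreover have "\<exists>!g. is_mate C c e' ev' e ev g"
    using e' ex unfolding is_exponential_def by auto
  ultimately have "mate C c e' ev' e ev = \<epsilon>"
    unfolding mate_def by (rule the1_equality[rotated])
  with \<epsilon> show ?thesis by simp
qed

lemma exponential_if_mate_iso:
  assumes e': "is_exponential C c b e' ev'" and c: "c \<in> Obj C" and a: "a \<in> Obj C"
    and f: "f \<in> hom C (Prd C a c) b" and iso: "iso C (mate C c e' ev' a f)"
  shows "is_exponential C c b a f"
proof -
  note ex = exp_arr[OF e']
  let ?m = "mate C c e' ev' a f"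
  have "is_mate C c e' ev' a f ?m"
    unfolding mate_def by (rule theI') (use e' a f in \<open>auto simp: is_exponential_def\<close>)
  then have m: "?m \<in> hom C a e'" and app: "\<And>x h k. h \<in> hom C x a \<Longrightarrow> k \<in> hom C x c \<Longrightarrow>
      ev' \<cdot> pairing C (?m \<cdot> h) k = f \<cdot> pairing C h k"
    using mate_generalised[of c e' ev' b a f ?m] c ex a f by auto
  show ?thesis
  proof (rule is_exponentialI[OF c a f])
    fix x p assume x: "x \<in> Obj C" and p: "p \<in> hom C (Prd C x c) b"
    from exp_curry[OF e' c x p] obtain g where g: "g \<in> hom C x e'"
      "\<And>y h k. h \<in> hom C y x \<Longrightarrow> k \<in> hom C y c \<Longrightarrow> ev' \<cdot> pairing C (g \<cdot> h) k = p \<cdot> pairing C h k"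
      by blast
    let ?g = "inv_arr C ?m \<cdot> g"
    have "f \<cdot> pairing C (?g \<cdot> h) k = p \<cdot> pairing C h k" if "h \<in> hom C y x" "k \<in> hom C y c" for y h k
      using app[of "?g \<cdot> h" y k] g(2)[OF that] g(1) that iso m by simp
    moreover have "?g \<in> hom C x a" using iso m g by simp
    ultimately show "\<exists>g \<in> hom C x a. \<forall>y h k. h \<in> hom C y x \<longrightarrow> k \<in> hom C y c \<longrightarrow>
        f \<cdot> pairing C (g \<cdot> h) k = p \<cdot> pairing C h k" by blast
  next
    fix x g g' assume g: "g \<in> hom C x a" "g' \<in> hom C x a"
      and eq: "\<And>y h k. h \<in> hom C y x \<Longrightarrow> k \<in> hom C y c \<Longrightarrow>
        f \<cdot> pairing C (g \<cdot> h) k = f \<cdot> pairing C (g' \<cdot> h) k"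
    have "?m \<cdot> g = ?m \<cdot> g'"
    proof (rule exp_ext[OF e' c])
      fix y h k assume hk: "h \<in> hom C y x" "k \<in> hom C y c"
      then show "ev' \<cdot> pairing C ((?m \<cdot> g) \<cdot> h) k = ev' \<cdot> pairing C ((?m \<cdot> g') \<cdot> h) k"
        using app[of "g \<cdot> h" y k] app[of "g' \<cdot> h" y k] eq[OF hk] g m by simp
    qed (use g m in auto)
    then have "inv_arr C ?m \<cdot> (?m \<cdot> g) = inv_arr C ?m \<cdot> (?m \<cdot> g')" by simp
    then show "g = g'" using g m iso by simp
  qed
qed

lemma exponential_transport:
  assumes e: "is_exponential C c b e ev" and \<gamma>: "iso C \<gamma>" "\<gamma> \<in> hom C d c"
  shows "is_exponential C d b e (ev \<cdot> prd_arr C (Idt C e) \<gamma>)"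
proof -
  note ex = exp_arr[OF e]
  have c: "c \<in> Obj C" "d \<in> Obj C" using \<gamma> by auto
  have ev: "(ev \<cdot> prd_arr C (Idt C e) \<gamma>) \<cdot> pairing C h k = ev \<cdot> pairing C h (\<gamma> \<cdot> k)"
    if "h \<in> hom C x e" "k \<in> hom C x d" for x h k
    using that ex \<gamma> by simp
  show ?thesis
  proof (rule is_exponentialI[OF c(2) ex(1)])
    show "ev \<cdot> prd_arr C (Idt C e) \<gamma> \<in> hom C (Prd C e d) b" using ex \<gamma> by simp
    fix a f assume a: "a \<in> Obj C" and f: "f \<in> hom C (Prd C a d) b"
    have "f \<cdot> prd_arr C (Idt C a) (inv_arr C \<gamma>) \<in> hom C (Prd C a c) b"
      using a f \<gamma> by simp
    from exp_curry[OF e c(1) a this] obtain g where g: "g \<in> hom C a e"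
      "\<And>x h k. h \<in> hom C x a \<Longrightarrow> k \<in> hom C x c \<Longrightarrow>
        ev \<cdot> pairing C (g \<cdot> h) k = (f \<cdot> prd_arr C (Idt C a) (inv_arr C \<gamma>)) \<cdot> pairing C h k"
      by blast
    have "(ev \<cdot> prd_arr C (Idt C e) \<gamma>) \<cdot> pairing C (g \<cdot> h) k = f \<cdot> pairing C h k"
      if "h \<in> hom C x a" "k \<in> hom C x d" for x h k
    proof -
      have "(ev \<cdot> prd_arr C (Idt C e) \<gamma>) \<cdot> pairing C (g \<cdot> h) k = ev \<cdot> pairing C (g \<cdot> h) (\<gamma> \<cdot> k)"
        by (rule ev) (use g that in auto)
      also have "\<dots> = (f \<cdot> prd_arr C (Idt C a) (inv_arr C \<gamma>)) \<cdot> pairing C h (\<gamma> \<cdot> k)"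
        by (rule g(2)) (use that \<gamma> in auto)
      also have "\<dots> = f \<cdot> pairing C h k"
        using that \<gamma> a f by simp
      finally show ?thesis .
    qed
    with g(1) show "\<exists>g \<in> hom C a e. \<forall>x h k. h \<in> hom C x a \<longrightarrow> k \<in> hom C x d \<longrightarrow>
        (ev \<cdot> prd_arr C (Idt C e) \<gamma>) \<cdot> pairing C (g \<cdot> h) k = f \<cdot> pairing C h k" by blast
  next
    fix a g g' assume g: "g \<in> hom C a e" "g' \<in> hom C a e"
      and eq: "\<And>x h k. h \<in> hom C x a \<Longrightarrow> k \<in> hom C x d \<Longrightarrow>
        (ev \<cdot> prd_arr C (Idt C e) \<gamma>) \<cdot> pairing C (g \<cdot> h) k =
        (ev \<cdot> prd_arr C (Idt C e) \<gamma>) \<cdot> pairing C (g' \<cdot> h) k"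
    show "g = g'"
    proof (rule exp_ext[OF e c(1) g])
      fix x h k assume "h \<in> hom C x a" "k \<in> hom C x c"
      then show "ev \<cdot> pairing C (g \<cdot> h) k = ev \<cdot> pairing C (g' \<cdot> h) k"
        using eq[of h x "inv_arr C \<gamma> \<cdot> k"] g ex \<gamma> by simp
    qed
  qed
qed

end


section \<open>Substitution and metasubstitution of elementary terms\<close>

lemma elementary_Var [simp]: "elementary \<Theta> n (Var i) \<longleftrightarrow> i < n"
  by (auto intro: elementary.intros elim: elementary.cases)

lemma elementary_Meta [simp]: "elementary \<Theta> n (Meta i ts) \<longleftrightarrow>
    i < length \<Theta> \<and> length ts = \<Theta> ! i \<and> (\<forall>t \<in> set ts. elementary \<Theta> n t)"
  by (auto intro: elementary.intros elim: elementary.cases)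

lemma elementary_weaken:
  "elementary \<Theta> n t \<Longrightarrow> n \<le> n' \<Longrightarrow> elementary (\<Theta> @ \<Psi>) n' t"
  by (induction t rule: trm.induct) (auto simp: nth_append)

lemma elementary_weaken_vars: "elementary \<Theta> n t \<Longrightarrow> n \<le> n' \<Longrightarrow> elementary \<Theta> n' t"
  using elementary_weaken[of \<Theta> n t n' "[]"] by simp

lemma elementary_gen [simp]:
  "elementary \<Theta> n (gen i m) \<longleftrightarrow> i < length \<Theta> \<and> \<Theta> ! i = m \<and> m \<le> n"
  by (auto simp: gen_def intro: leI)

lemma elementary_subst:
  assumes "elementary \<Theta> (length us + n) t" "\<forall>u \<in> set us. elementary \<Theta> n u"
  shows "elementary \<Theta> n (subst us t)"
  using assms(1) by (induction t rule: trm.induct) (use assms(2) in auto)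

lemma elementary_msubst:
  assumes "elementary \<Theta> n t" "\<And>i. i < length \<Theta> \<Longrightarrow> elementary \<Theta>' (\<Theta> ! i + n) (ss ! i)"
  shows "elementary \<Theta>' n (msubst ss t)"
  using assms(1)
proof (induction t rule: trm.induct)
  case (Meta i ts)
  then show ?case
    using assms(2)[of i] by (auto intro!: elementary_subst)
qed simp

lemma subst_vars [simp]: "elementary \<Theta> n t \<Longrightarrow> subst (map Var [0..<n]) t = t"
  by (induction t rule: trm.induct) (auto simp: map_idI)

lemma subst_Nil [simp]: "subst [] t = t"
  by (induction t rule: trm.induct) (auto simp: map_idI)

lemma subst_gen [simp]: "length ts = n \<Longrightarrow> subst ts (gen i n) = Meta i ts"
  by (auto simp: gen_def intro: nth_equalityI)

text \<open>All variables of \<open>t\<close> are among those replaced by \<open>us\<close>; without this condition the renumbering of the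
  remaining variables would get in the way.\<close>

lemma subst_subst:
  assumes "elementary \<Theta> (length us) t"
  shows "subst vs (subst us t) = subst (map (subst vs) us) t"
  using assms by (induction t rule: trm.induct) auto

lemma msubst_subst:
  assumes "elementary \<Theta> (length us) t" "\<And>i. i < length \<Theta> \<Longrightarrow> elementary \<Theta>' (\<Theta> ! i) (ss ! i)"
  shows "msubst ss (subst us t) = subst (map (msubst ss) us) (msubst ss t)"
  using assms(1)
proof (induction t rule: trm.induct)
  case (Meta i ts)
  then have "map (msubst ss \<circ> subst us) ts = map (subst (map (msubst ss) us) \<circ> msubst ss) ts"
    by auto
  with Meta.prems assms(2)[of i] show ?case
    by (simp add: subst_subst[of \<Theta>'] del: map_eq_conv)
qed simp

lemma msubst_msubst:
  assumes "elementary \<Theta> n t" "length ss = length \<Theta>"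
    and "\<And>i. i < length \<Theta> \<Longrightarrow> elementary \<Theta>' (\<Theta> ! i) (ss ! i)"
    and "\<And>i. i < length \<Theta>' \<Longrightarrow> elementary \<Theta>'' (\<Theta>' ! i) (rs ! i)"
  shows "msubst rs (msubst ss t) = msubst (map (msubst rs) ss) t"
  using assms(1)
proof (induction t rule: trm.induct)
  case (Meta i ts)
  then have "map (msubst rs \<circ> msubst ss) ts = map (msubst (map (msubst rs) ss)) ts"
    by auto
  with Meta.prems assms(2) assms(3)[of i] show ?case
    by (simp add: msubst_subst[OF _ assms(4)] del: map_eq_conv)
qed simp

lemma msubst_gen: "elementary \<Theta> n (ss ! i) \<Longrightarrow> msubst ss (gen i n) = ss ! i"
  by (simp add: gen_def o_def)

lemma msubst_gens:
  assumes "elementary \<Theta> n t" "\<And>i. i < length \<Theta> \<Longrightarrow> ss ! i = gen i (\<Theta> ! i)"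
  shows "msubst ss t = t"
  using assms(1)
proof (induction t rule: trm.induct)
  case (Meta i ts)
  then have "map (msubst ss) ts = ts"
    by (auto intro: map_idI)
  then show ?case
    using Meta.prems assms(2)[of i] by simp
qed simp


section \<open>The cartesian structure of the theory of equality\<close>

lemma MM_simps [simp]:
  "Obj MM = UNIV"
  "(ms, ts, ns) \<in> Arr MM \<longleftrightarrow> length ts = length ns \<and> (\<forall>i < length ns. elementary ms (ns ! i) (ts ! i))"
  "Dom MM (ms, ts, ns) = ms" "Cod MM (ms, ts, ns) = ns"
  "Idt MM ms = (ms, map (\<lambda>i. gen i (ms ! i)) [0..<length ms], ms)"
  "(ms, ts, ns) \<cdot>\<^bsub>MM\<^esub> (ls, ss, ms') = (ls, map (msubst ss) ts, ns)"
  "One MM = []" "Prd MM ms ns = ms @ ns"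
  "Fst MM ms ns = (ms @ ns, map (\<lambda>i. gen i (ms ! i)) [0..<length ms], ms)"
  "Snd MM ms ns = (ms @ ns, map (\<lambda>i. gen (length ms + i) (ns ! i)) [0..<length ns], ns)"
  by (simp_all add: MM_def)

lemma hom_MM_E:
  assumes "f \<in> hom MM ms ns"
  obtains ts where "f = (ms, ts, ns)" "length ts = length ns"
    "\<forall>i < length ns. elementary ms (ns ! i) (ts ! i)"
  using assms by (cases f) auto

lemma map_eqI:
  assumes "length ts = length us" "\<And>i. i < length us \<Longrightarrow> f (ts ! i) = us ! i"
  shows "map f ts = us"
  using assms by (auto intro: nth_equalityI)

lemma category_MM: "category MM"
proof
  fix a show "Idt MM a \<in> hom MM a a" by simp
next
  fix f g :: marr and a b c
  assume "f \<in> hom MM a b" "g \<in> hom MM b c"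
  then show "g \<cdot>\<^bsub>MM\<^esub> f \<in> hom MM a c"
    by (elim hom_MM_E) (auto intro!: elementary_msubst elementary_weaken_vars[OF _ le_add1])
next
  fix f :: marr and a b
  assume "f \<in> hom MM a b"
  then show "f \<cdot>\<^bsub>MM\<^esub> Idt MM a = f"
    by (elim hom_MM_E) (auto intro!: map_eqI msubst_gens)
next
  fix f :: marr and a b
  assume "f \<in> hom MM a b"
  then show "Idt MM b \<cdot>\<^bsub>MM\<^esub> f = f"
    by (elim hom_MM_E) (auto intro!: map_eqI msubst_gen)
next
  fix f g h :: marr and a b c d
  assume "f \<in> hom MM a b" "g \<in> hom MM b c" "h \<in> hom MM c d"
  then show "(h \<cdot>\<^bsub>MM\<^esub> g) \<cdot>\<^bsub>MM\<^esub> f = h \<cdot>\<^bsub>MM\<^esub> (g \<cdot>\<^bsub>MM\<^esub> f)"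
  proof (elim hom_MM_E)
    fix ss ts us
    assume f: "f = (a, ss, b)" "length ss = length b" "\<forall>i < length b. elementary a (b ! i) (ss ! i)"
      and g: "g = (b, ts, c)" "length ts = length c" "\<forall>i < length c. elementary b (c ! i) (ts ! i)"
      and h: "h = (c, us, d)" "length us = length d" "\<forall>i < length d. elementary c (d ! i) (us ! i)"
    have "msubst ss (msubst ts (us ! i)) = msubst (map (msubst ss) ts) (us ! i)"
      if "i < length us" for i
      by (rule msubst_msubst[where \<Theta> = c and \<Theta>' = b and \<Theta>'' = a and n = "d ! i"])
        (use f g h that in auto)
    then have "map (msubst ss) (map (msubst ts) us) = map (msubst (map (msubst ss) ts)) us"
      by (simp add: list_eq_iff_nth_eq del: map_map map_eq_conv)
    then show ?thesis
      using f g h by (simp del: map_map map_eq_conv)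
  qed
qed simp_all

lemma Fst_comp_MM:
  assumes "h \<in> hom MM ls (ms @ ns)"
  shows "Fst MM ms ns \<cdot>\<^bsub>MM\<^esub> h = (ls, take (length ms) (fst (snd h)), ms)"
proof -
  from assms obtain ts where h: "h = (ls, ts, ms @ ns)" "length ts = length (ms @ ns)"
    "\<forall>i < length (ms @ ns). elementary ls ((ms @ ns) ! i) (ts ! i)"
    by (rule hom_MM_E)
  have "elementary ls (ms ! i) (ts ! i)" if "i < length ms" for i
    using h(3)[rule_format, of i] that by (simp add: nth_append)
  then show ?thesis
    using h(1,2) by (auto intro!: map_eqI msubst_gen)
qed

lemma Snd_comp_MM:
  assumes "h \<in> hom MM ls (ms @ ns)"
  shows "Snd MM ms ns \<cdot>\<^bsub>MM\<^esub> h = (ls, drop (length ms) (fst (snd h)), ns)"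
proof -
  from assms obtain ts where h: "h = (ls, ts, ms @ ns)" "length ts = length (ms @ ns)"
    "\<forall>i < length (ms @ ns). elementary ls ((ms @ ns) ! i) (ts ! i)"
    by (rule hom_MM_E)
  have "elementary ls (ns ! i) (ts ! (length ms + i))" if "i < length ns" for i
    using h(3)[rule_format, of "length ms + i"] that by simp
  then show ?thesis
    using h(1,2) by (auto intro!: map_eqI msubst_gen)
qed

lemma cartesian_category_MM: "cartesian_category MM"
proof -
  interpret category MM by (rule category_MM)
  show ?thesis
  proof
    fix a :: "nat list"
    show "\<exists>!f. f \<in> hom MM a (One MM)"
    proof
      show "(a, [], []) \<in> hom MM a (One MM)" by simp
    qed (auto elim!: hom_MM_E)
  next
    fix f g :: marr and x a b
    assume f: "f \<in> hom MM x a" and g: "g \<in> hom MM x b"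
    from f obtain ts where ts: "f = (x, ts, a)" "length ts = length a"
      "\<forall>i < length a. elementary x (a ! i) (ts ! i)" by (rule hom_MM_E)
    from g obtain us where us: "g = (x, us, b)" "length us = length b"
      "\<forall>i < length b. elementary x (b ! i) (us ! i)" by (rule hom_MM_E)
    show "\<exists>!h. h \<in> hom MM x (Prd MM a b) \<and> Fst MM a b \<cdot>\<^bsub>MM\<^esub> h = f \<and> Snd MM a b \<cdot>\<^bsub>MM\<^esub> h = g"
    proof
      have "(x, ts @ us, a @ b) \<in> hom MM x (a @ b)"
        using ts us by (auto simp: nth_append)
      from this Fst_comp_MM[OF this] Snd_comp_MM[OF this]
      show "(x, ts @ us, a @ b) \<in> hom MM x (Prd MM a b) \<and>
          Fst MM a b \<cdot>\<^bsub>MM\<^esub> (x, ts @ us, a @ b) = f \<and> Snd MM a b \<cdot>\<^bsub>MM\<^esub> (x, ts @ us, a @ b) = g"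
        using ts us by simp
    next
      fix h assume h: "h \<in> hom MM x (Prd MM a b) \<and> Fst MM a b \<cdot>\<^bsub>MM\<^esub> h = f \<and> Snd MM a b \<cdot>\<^bsub>MM\<^esub> h = g"
      then have h': "h \<in> hom MM x (a @ b)" by simp
      then obtain rs where rs: "h = (x, rs, a @ b)" by (rule hom_MM_E)
      have "take (length a) rs = ts" "drop (length a) rs = us"
        using h Fst_comp_MM[OF h'] Snd_comp_MM[OF h'] ts us rs by auto
      then show "h = (x, ts @ us, a @ b)" using rs append_take_drop_id by metis
    qed
  qed (auto simp: nth_append)
qed

interpretation MM: cartesian_category MM
  by (rule cartesian_category_MM)

lemma pairing_MM:
  assumes "(ls, ts, ms) \<in> Arr MM" "(ls, us, ns) \<in> Arr MM"
  shows "pairing MM (ls, ts, ms) (ls, us, ns) = (ls, ts @ us, ms @ ns)"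
proof -
  have h: "(ls, ts @ us, ms @ ns) \<in> hom MM ls (ms @ ns)"
    using assms by (auto simp: nth_append)
  show ?thesis
    by (rule MM.pairing_ext[of _ ls ms ns])
      (use assms h Fst_comp_MM[OF h] Snd_comp_MM[OF h] in \<open>auto simp del: MM_simps(9,10)\<close>)
qed


section \<open>Exponentiating by the generic object\<close>

text \<open>Currying is transparent for terms: a term over \<open>ls\<close> with \<open>n + 1\<close> variables and a term over \<open>ls @ [0]\<close>
  with \<open>n\<close> variables differ only in whether the extra argument is written as the last variable or as
  the nullary metavariable at position \<open>length ls\<close>. The latter is replaced by a variable
  through metasubstitution, in which \<open>Var n\<close> is a variable of the ambient context, since the
  metavariable binds none.\<close>

definition uncurry_trm :: "nat \<Rightarrow> nat \<Rightarrow> trm \<Rightarrow> trm" where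
  "uncurry_trm l n = subst (map Var [0..<n] @ [Meta l []])"

definition curry_trm :: "nat list \<Rightarrow> nat \<Rightarrow> trm \<Rightarrow> trm" where
  "curry_trm ls n = msubst (map (\<lambda>i. gen i (ls ! i)) [0..<length ls] @ [Var n])"

lemma elementary_uncurry_trm:
  assumes "elementary ls (Suc n) t"
  shows "elementary (ls @ [0]) n (uncurry_trm (length ls) n t)"
  using elementary_weaken[OF assms, of "Suc n + n" "[0]"] unfolding uncurry_trm_def
  by (intro elementary_subst) auto

lemma elementary_curry_trm:
  assumes "elementary (ls @ [0]) n u"
  shows "elementary ls (Suc n) (curry_trm ls n u)"
  unfolding curry_trm_def
  by (rule elementary_msubst[of "ls @ [0]"])
    (use elementary_weaken_vars[OF assms, of "Suc n"] in \<open>auto simp: nth_append less_Suc_eq\<close>)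

lemma curry_uncurry_trm:
  assumes "elementary ls (Suc n) t"
  shows "curry_trm ls n (uncurry_trm (length ls) n t) = t"
  using assms
proof (induction t rule: trm.induct)
  case (Meta i ts)
  then have "map (curry_trm ls n \<circ> uncurry_trm (length ls) n) ts = ts"
    by (auto intro: map_idI)
  then show ?case
    using Meta.prems by (simp add: curry_trm_def uncurry_trm_def nth_append)
qed (auto simp: curry_trm_def uncurry_trm_def nth_append less_Suc_eq)

lemma uncurry_curry_trm:
  assumes "elementary (ls @ [0]) n u"
  shows "uncurry_trm (length ls) n (curry_trm ls n u) = u"
  using assms
proof (induction u rule: trm.induct)
  case (Meta i ts)
  then have "map (uncurry_trm (length ls) n \<circ> curry_trm ls n) ts = ts"
    by (auto intro: map_idI)
  then show ?case
    using Meta.prems by (auto simp: curry_trm_def uncurry_trm_def nth_append less_Suc_eq)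
qed (auto simp: curry_trm_def uncurry_trm_def nth_append less_Suc_eq)

lemma length_MM_exp [simp]: "length (MM_exp ms) = length ms"
  by (simp add: MM_exp_def)

lemma nth_MM_exp [simp]: "i < length ms \<Longrightarrow> MM_exp ms ! i = Suc (ms ! i)"
  by (simp add: MM_exp_def)

lemma MM_ev_hom: "MM_ev ms \<in> hom MM (Prd MM (MM_exp ms) [0]) ms"
  by (auto simp: MM_ev_def MM_exp_def nth_append)

lemma MM_ev_comp:
  assumes "(ls, ts, MM_exp ms) \<in> Arr MM" "(ls, [u], [0]) \<in> Arr MM"
  shows "MM_ev ms \<cdot>\<^bsub>MM\<^esub> pairing MM (ls, ts, MM_exp ms) (ls, [u], [0]) =
    (ls, map (\<lambda>i. subst (map Var [0..<ms ! i] @ [u]) (ts ! i)) [0..<length ms], ms)"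
  using assms
  by (auto simp: pairing_MM MM_ev_def MM_exp_def nth_append o_def)

text \<open>Composing with the evaluation after weakening to \<open>ls @ [0]\<close> is uncurrying of terms, so that the
  universal property of the exponential becomes the bijection between \<open>uncurry_trm\<close> and
  \<open>curry_trm\<close>.\<close>

lemma MM_mate:
  assumes "(ls, ts, MM_exp ms) \<in> Arr MM"
  shows "MM_ev ms \<cdot>\<^bsub>MM\<^esub> prd_arr MM (ls, ts, MM_exp ms) (Idt MM [0]) =
    (ls @ [0], map (\<lambda>i. uncurry_trm (length ls) (ms ! i) (ts ! i)) [0..<length ms], ms)"
proof -
  have 1: "(ls, ts, MM_exp ms) \<cdot>\<^bsub>MM\<^esub> Fst MM ls [0] = (ls @ [0], ts, MM_exp ms)"
    using assms by (auto intro!: map_eqI msubst_gens)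
  have 2: "Idt MM [0] \<cdot>\<^bsub>MM\<^esub> Snd MM ls [0] = (ls @ [0], [Meta (length ls) []], [0])"
    by (simp add: gen_def)
  have "(ls @ [0], ts, MM_exp ms) \<in> Arr MM"
    using assms by (simp add: elementary_weaken[OF _ order_refl])
  then show ?thesis
    unfolding prd_arr_def using MM_ev_comp[of "ls @ [0]" ts ms "Meta (length ls) []"] 1 2
    by (simp add: uncurry_trm_def del: MM_simps(5,6,9,10))
qed

lemma is_exponential_MM: "is_exponential MM [0] ms (MM_exp ms) (MM_ev ms)"
  unfolding is_exponential_def
proof (intro conjI ballI)
  fix ls f assume "f \<in> hom MM (Prd MM ls [0]) ms"
  then obtain us where us: "f = (ls @ [0], us, ms)" "length us = length ms"
    "\<forall>i < length ms. elementary (ls @ [0]) (ms ! i) (us ! i)"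
    by (simp only: MM_simps) (erule hom_MM_E)
  let ?ts = "map (\<lambda>i. curry_trm ls (ms ! i) (us ! i)) [0..<length ms]"
  show "\<exists>!g. is_mate MM [0] (MM_exp ms) (MM_ev ms) ls f g"
  proof
    have "(ls, ?ts, MM_exp ms) \<in> Arr MM"
      using us by (auto simp: MM_exp_def elementary_curry_trm)
    from MM_mate[OF this] this
    show "is_mate MM [0] (MM_exp ms) (MM_ev ms) ls f (ls, ?ts, MM_exp ms)"
      unfolding is_mate_def
      using us by (auto simp: uncurry_curry_trm intro!: map_eqI simp del: MM_simps(5))
  next
    fix g assume g: "is_mate MM [0] (MM_exp ms) (MM_ev ms) ls f g"
    then have "g \<in> hom MM ls (MM_exp ms)" by (simp add: is_mate_def)
    then obtain ts where ts: "g = (ls, ts, MM_exp ms)" "length ts = length (MM_exp ms)"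
      "\<forall>i < length (MM_exp ms). elementary ls (MM_exp ms ! i) (ts ! i)"
      by (rule hom_MM_E)
    have g': "(ls, ts, MM_exp ms) \<in> Arr MM" using ts by simp
    have eq: "us = map (\<lambda>i. uncurry_trm (length ls) (ms ! i) (ts ! i)) [0..<length ms]"
      using g MM_mate[OF g'] us ts(1) by (simp add: is_mate_def del: MM_simps(5))
    have "ts = ?ts"
    proof (rule nth_equalityI)
      fix i assume "i < length ts"
      then have i: "i < length ms" using ts by (simp add: MM_exp_def)
      then have "elementary ls (Suc (ms ! i)) (ts ! i)"
        using ts(3)[rule_format, of i] by (simp add: MM_exp_def)
      then show "ts ! i = ?ts ! i"
        using i eq by (simp add: curry_uncurry_trm)
    qed (use ts in \<open>simp add: MM_exp_def\<close>)
    then show "g = (ls, ?ts, MM_exp ms)" using ts by simp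
  qed
qed (use MM_ev_hom in auto)


section \<open>Interpreting terms in a tower of exponentials\<close>

locale exponential_tower = cartesian_category C
  for C :: "('o, 'a, 'z) ccat_scheme" (structure) +
  fixes E :: "nat \<Rightarrow> 'o" and ev :: "nat \<Rightarrow> 'a"
  assumes E_0_obj: "E 0 \<in> Obj C"
    and E_exp: "is_exponential C (E 0) (E m) (E (Suc m)) (ev m)"
begin

lemma E_obj [simp]: "E m \<in> Obj C"
  using E_0_obj exp_arr(1)[OF E_exp] by (cases m) auto

lemma ev_arr [simp]:
  "ev m \<in> Arr C" "Dom C (ev m) = Prd C (E (Suc m)) (E 0)" "Cod C (ev m) = E m"
  using exp_arr[OF E_exp] by auto

text \<open>\<open>app m f \<sigma>\<close> applies \<open>f\<close>, a generalised element of the \<open>m\<close>-fold exponential \<open>E m\<close>, to the arguments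
  \<open>\<sigma> 0, \<dots>, \<sigma> (m - 1)\<close>. The last argument is consumed first, since the evaluation \<open>MM_ev\<close> appends its
  argument at the end of the argument list.\<close>

primrec app :: "nat \<Rightarrow> 'a \<Rightarrow> (nat \<Rightarrow> 'a) \<Rightarrow> 'a" where
  "app 0 f \<sigma> = f"
| "app (Suc m) f \<sigma> = app m (ev m \<cdot> pairing C f (\<sigma> m)) \<sigma>"

primrec eval :: "(nat \<Rightarrow> 'a) \<Rightarrow> (nat \<Rightarrow> 'a) \<Rightarrow> trm \<Rightarrow> 'a" where
  "eval \<rho> \<sigma> (Var i) = \<sigma> i"
| "eval \<rho> \<sigma> (Meta i ts) = app (length ts) (\<rho> i) (\<lambda>j. map (eval \<rho> \<sigma>) ts ! j)"

lemma app_cong: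
  assumes "\<And>j. j < m \<Longrightarrow> \<sigma> j = \<sigma>' j"
  shows "app m f \<sigma> = app m f \<sigma>'"
  using assms by (induction m arbitrary: f) auto

lemma app_hom:
  assumes "f \<in> hom C x (E m)" "\<forall>j < m. \<sigma> j \<in> hom C x (E 0)"
  shows "app m f \<sigma> \<in> hom C x (E 0)"
  using assms by (induction m arbitrary: f) (auto simp del: in_hom, auto)

lemma app_comp:
  assumes "f \<in> hom C x (E m)" "\<forall>j < m. \<sigma> j \<in> hom C x (E 0)" "k \<in> hom C y x"
  shows "app m f \<sigma> \<cdot> k = app m (f \<cdot> k) (\<lambda>j. \<sigma> j \<cdot> k)"
  using assms
proof (induction m arbitrary: f)
  case (Suc m)
  have "app m (ev m \<cdot> pairing C f (\<sigma> m)) \<sigma> \<cdot> k =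
      app m ((ev m \<cdot> pairing C f (\<sigma> m)) \<cdot> k) (\<lambda>j. \<sigma> j \<cdot> k)"
    by (rule Suc.IH) (use Suc.prems in auto)
  with Suc.prems show ?case by simp
qed simp

text \<open>Extensionality for iterated exponentials. The arguments \<open>\<sigma>\<close> range over all stages \<open>x\<close> over \<open>a\<close>, because
  an arrow into \<open>E m\<close> need not be determined by its values at arguments of stage \<open>a\<close>.\<close>

lemma app_ext:
  assumes "f \<in> hom C a (E m)" "g \<in> hom C a (E m)"
    and "\<And>x h \<sigma>. h \<in> hom C x a \<Longrightarrow> \<forall>j < m. \<sigma> j \<in> hom C x (E 0) \<Longrightarrow>
      app m (f \<cdot> h) \<sigma> = app m (g \<cdot> h) \<sigma>"
  shows "f = g"
  using assms
proof (induction m arbitrary: a f g)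
  case 0
  have a: "a \<in> Obj C" using 0(1) by auto
  have "app 0 (f \<cdot> Idt C a) (\<lambda>_. f) = app 0 (g \<cdot> Idt C a) (\<lambda>_. f)"
    by (rule 0(3)[of _ a]) (use a in auto)
  with 0(1,2) show ?case by simp
next
  case (Suc m)
  show ?case
  proof (rule exp_ext[OF E_exp E_obj Suc.prems(1,2)])
    fix x h k assume h: "h \<in> hom C x a" and k: "k \<in> hom C x (E 0)"
    show "ev m \<cdot> pairing C (f \<cdot> h) k = ev m \<cdot> pairing C (g \<cdot> h) k"
    proof (rule Suc.IH[of _ x])
      fix y l \<sigma> assume l: "l \<in> hom C y x" and \<sigma>: "\<forall>j < m. \<sigma> j \<in> hom C y (E 0)"
      have *: "app m ((ev m \<cdot> pairing C (p \<cdot> h) k) \<cdot> l) \<sigma> =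
          app (Suc m) (p \<cdot> (h \<cdot> l)) (\<sigma>(m := k \<cdot> l))" if "p \<in> hom C a (E (Suc m))" for p
        using that h k l app_cong[of m \<sigma> "\<sigma>(m := k \<cdot> l)"] by simp
      show "app m ((ev m \<cdot> pairing C (f \<cdot> h) k) \<cdot> l) \<sigma> = app m ((ev m \<cdot> pairing C (g \<cdot> h) k) \<cdot> l) \<sigma>"
        unfolding *[OF Suc.prems(1)] *[OF Suc.prems(2)]
      proof (rule Suc.prems(3))
        show "h \<cdot> l \<in> hom C y a" using h l by simp
        show "\<forall>j < Suc m. (\<sigma>(m := k \<cdot> l)) j \<in> hom C y (E 0)"
          using k l \<sigma> by (simp add: less_Suc_eq)
      qed
    qed (use Suc.prems(1,2) h k in auto)
  qed
qed

text \<open>Every family of operations natural in the stage is represented by an arrow into the iterated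
  exponential. In the induction step the last argument is moved into the parameter object, which
  grows from \<open>a\<close> to \<open>Prd C a (E 0)\<close>, and is then abstracted by currying.\<close>

lemma app_abstraction:
  assumes "a \<in> Obj C"
    and "\<And>x h \<sigma>. h \<in> hom C x a \<Longrightarrow> \<forall>j < m. \<sigma> j \<in> hom C x (E 0) \<Longrightarrow> \<phi> h \<sigma> \<in> hom C x (E 0)"
    and "\<And>x y h k \<sigma>. h \<in> hom C x a \<Longrightarrow> \<forall>j < m. \<sigma> j \<in> hom C x (E 0) \<Longrightarrow> k \<in> hom C y x \<Longrightarrow>
      \<phi> h \<sigma> \<cdot> k = \<phi> (h \<cdot> k) (\<lambda>j. \<sigma> j \<cdot> k)"
    and "\<And>h \<sigma> \<sigma>'. (\<And>j. j < m \<Longrightarrow> \<sigma> j = \<sigma>' j) \<Longrightarrow> \<phi> h \<sigma> = \<phi> h \<sigma>'"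
  shows "\<exists>f \<in> hom C a (E m). \<forall>x h \<sigma>. h \<in> hom C x a \<longrightarrow> (\<forall>j < m. \<sigma> j \<in> hom C x (E 0)) \<longrightarrow>
    app m (f \<cdot> h) \<sigma> = \<phi> h \<sigma>"
  using assms
proof (induction m arbitrary: a \<phi>)
  case 0
  define \<sigma> :: "nat \<Rightarrow> 'a" where "\<sigma> = (\<lambda>_. Idt C a)"
  have "\<phi> (Idt C a) \<sigma> \<in> hom C a (E 0)"
    by (rule 0(2)) (use 0(1) in auto)
  moreover have "app 0 (\<phi> (Idt C a) \<sigma> \<cdot> h) \<sigma>' = \<phi> h \<sigma>'" if "h \<in> hom C x a" for x h \<sigma>'
  proof -
    have "\<phi> (Idt C a) \<sigma> \<cdot> h = \<phi> (Idt C a \<cdot> h) (\<lambda>j. \<sigma> j \<cdot> h)"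
      by (rule 0(3)) (use 0(1) that in auto)
    also have "\<dots> = \<phi> h \<sigma>'"
      using 0(4)[of "\<lambda>j. \<sigma> j \<cdot> h" \<sigma>' h] that by simp
    finally show ?thesis by simp
  qed
  ultimately show ?case by blast
next
  case (Suc m)
  let ?p = "Prd C a (E 0)"
  \<comment> \<open>The generalised element \<open>k\<close> of the product supplies both the parameter and the argument at position \<open>m\<close>.\<close>
  define \<psi> where "\<psi> = (\<lambda>k \<sigma>. \<phi> (Fst C a (E 0) \<cdot> k) (\<sigma>(m := Snd C a (E 0) \<cdot> k)))"
  have "\<exists>f \<in> hom C ?p (E m). \<forall>x h \<sigma>. h \<in> hom C x ?p \<longrightarrow> (\<forall>j < m. \<sigma> j \<in> hom C x (E 0)) \<longrightarrow>
      app m (f \<cdot> h) \<sigma> = \<psi> h \<sigma>"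
  proof (rule Suc.IH)
    fix x h \<sigma> assume "h \<in> hom C x ?p" "\<forall>j < m. \<sigma> j \<in> hom C x (E 0)"
    then show "\<psi> h \<sigma> \<in> hom C x (E 0)"
      unfolding \<psi>_def using Suc.prems(1) by (intro Suc.prems(2)) (auto simp: less_Suc_eq)
  next
    fix x y h k \<sigma>
    assume h: "h \<in> hom C x ?p" and \<sigma>: "\<forall>j < m. \<sigma> j \<in> hom C x (E 0)" and k: "k \<in> hom C y x"
    have "\<psi> h \<sigma> \<cdot> k = \<phi> ((Fst C a (E 0) \<cdot> h) \<cdot> k) (\<lambda>j. (\<sigma>(m := Snd C a (E 0) \<cdot> h)) j \<cdot> k)"
      unfolding \<psi>_def using Suc.prems(1) h k \<sigma>
      by (intro Suc.prems(3)[where x = x and y = y]) (auto simp: less_Suc_eq)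
    also have "\<dots> = \<psi> (h \<cdot> k) (\<lambda>j. \<sigma> j \<cdot> k)"
      unfolding \<psi>_def using Suc.prems(1) h k by (intro arg_cong2[where f = \<phi>]) auto
    finally show "\<psi> h \<sigma> \<cdot> k = \<psi> (h \<cdot> k) (\<lambda>j. \<sigma> j \<cdot> k)" .
  next
    fix h and \<sigma> \<sigma>' :: "nat \<Rightarrow> 'a" assume "\<And>j. j < m \<Longrightarrow> \<sigma> j = \<sigma>' j"
    then show "\<psi> h \<sigma> = \<psi> h \<sigma>'"
      unfolding \<psi>_def by (intro Suc.prems(4)) (auto simp: less_Suc_eq)
  qed (use Suc.prems(1) in auto)
  then obtain f where f: "f \<in> hom C ?p (E m)" "\<And>x h \<sigma>. h \<in> hom C x ?p \<Longrightarrow>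
      \<forall>j < m. \<sigma> j \<in> hom C x (E 0) \<Longrightarrow> app m (f \<cdot> h) \<sigma> = \<psi> h \<sigma>"
    by blast
  obtain g where g: "g \<in> hom C a (E (Suc m))" "\<And>x h k. h \<in> hom C x a \<Longrightarrow> k \<in> hom C x (E 0) \<Longrightarrow>
      ev m \<cdot> pairing C (g \<cdot> h) k = f \<cdot> pairing C h k"
    using exp_curry[OF E_exp E_obj Suc.prems(1) f(1)] by blast
  have "app (Suc m) (g \<cdot> h) \<sigma> = \<phi> h \<sigma>"
    if h: "h \<in> hom C x a" and \<sigma>: "\<forall>j < Suc m. \<sigma> j \<in> hom C x (E 0)" for x h \<sigma>
  proof -
    have "app (Suc m) (g \<cdot> h) \<sigma> = app m (f \<cdot> pairing C h (\<sigma> m)) \<sigma>"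
      using g(2)[OF h] \<sigma> by simp
    also have "\<dots> = \<psi> (pairing C h (\<sigma> m)) \<sigma>"
      by (rule f(2)[of _ x]) (use h \<sigma> in auto)
    also have "\<dots> = \<phi> h \<sigma>"
      using h \<sigma> by (simp add: \<psi>_def)
    finally show ?thesis .
  qed
  with g(1) show ?case by blast
qed

lemma eval_hom:
  assumes "elementary \<Theta> n t" "\<forall>i < length \<Theta>. \<rho> i \<in> hom C x (E (\<Theta> ! i))"
    "\<forall>j < n. \<sigma> j \<in> hom C x (E 0)"
  shows "eval \<rho> \<sigma> t \<in> hom C x (E 0)"
  using assms(1)
proof (induction t rule: trm.induct)
  case (Meta i ts)
  then show ?case
    unfolding eval.simps using assms(2) by (intro app_hom) (auto simp del: in_hom)
qed (use assms(3) in auto)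

lemma eval_comp:
  assumes "elementary \<Theta> n t" "\<forall>i < length \<Theta>. \<rho> i \<in> hom C x (E (\<Theta> ! i))"
    "\<forall>j < n. \<sigma> j \<in> hom C x (E 0)" "k \<in> hom C y x"
  shows "eval \<rho> \<sigma> t \<cdot> k = eval (\<lambda>i. \<rho> i \<cdot> k) (\<lambda>j. \<sigma> j \<cdot> k) t"
  using assms(1)
proof (induction t rule: trm.induct)
  case (Meta i ts)
  have "eval \<rho> \<sigma> (Meta i ts) \<cdot> k = app (length ts) (\<rho> i \<cdot> k) (\<lambda>j. (map (eval \<rho> \<sigma>) ts ! j) \<cdot> k)"
    unfolding eval.simps using Meta.prems assms(2-)
    by (intro app_comp[of _ x _ _ _ y]) (auto simp del: in_hom intro: eval_hom[of \<Theta> n])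
  also have "\<dots> = eval (\<lambda>i. \<rho> i \<cdot> k) (\<lambda>j. \<sigma> j \<cdot> k) (Meta i ts)"
    unfolding eval.simps using Meta by (intro app_cong) simp
  finally show ?case .
qed simp

lemma eval_cong:
  assumes "elementary \<Theta> n t" "\<And>i. i < length \<Theta> \<Longrightarrow> \<rho> i = \<rho>' i" "\<And>j. j < n \<Longrightarrow> \<sigma> j = \<sigma>' j"
  shows "eval \<rho> \<sigma> t = eval \<rho>' \<sigma>' t"
  using assms(1) by (induction t rule: trm.induct) (use assms(2,3) in \<open>auto intro!: app_cong\<close>)

lemma eval_subst:
  assumes "elementary \<Theta> (length us) t"
  shows "eval \<rho> \<sigma> (subst us t) = eval \<rho> (\<lambda>j. eval \<rho> \<sigma> (us ! j)) t"
  using assms by (induction t rule: trm.induct) (auto intro!: app_cong)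

text \<open>The environment \<open>\<rho>'\<close> interprets each metavariable by an arrow representing the term that is
  substituted for it. The stage \<open>x\<close> stays fixed, as elementary terms bind no variables.\<close>

lemma eval_msubst:
  assumes "elementary \<Theta> n t" "\<forall>j < n. \<sigma> j \<in> hom C x (E 0)"
    and "\<forall>i < length \<Theta>'. \<rho> i \<in> hom C x (E (\<Theta>' ! i))"
    and "\<forall>i < length \<Theta>. \<rho>' i \<in> hom C x (E (\<Theta> ! i))"
    and "\<forall>i < length \<Theta>. elementary \<Theta>' (\<Theta> ! i) (ss ! i)"
    and "\<And>i \<tau>. i < length \<Theta> \<Longrightarrow> \<forall>j < \<Theta> ! i. \<tau> j \<in> hom C x (E 0) \<Longrightarrow>
      eval \<rho> \<tau> (ss ! i) = app (\<Theta> ! i) (\<rho>' i) \<tau>"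
  shows "eval \<rho> \<sigma> (msubst ss t) = eval \<rho>' \<sigma> t"
  using assms(1)
proof (induction t rule: trm.induct)
  case (Meta i ts)
  let ?\<tau> = "\<lambda>j. map (eval \<rho>' \<sigma>) ts ! j"
  have i: "i < length \<Theta>" "\<Theta> ! i = length ts" and ts: "\<forall>t \<in> set ts. elementary \<Theta> n t"
    using Meta.prems by auto
  have "eval \<rho> \<sigma> (msubst ss (Meta i ts)) = eval \<rho> (\<lambda>j. eval \<rho> \<sigma> (map (msubst ss) ts ! j)) (ss ! i)"
    using i assms(5) eval_subst[of \<Theta>' "map (msubst ss) ts" "ss ! i" \<rho> \<sigma>] by auto
  also have "\<dots> = eval \<rho> ?\<tau> (ss ! i)"
    by (rule eval_cong[of \<Theta>' "\<Theta> ! i"]) (use i ts Meta.IH assms(5) in auto)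
  also have "\<dots> = app (\<Theta> ! i) (\<rho>' i) ?\<tau>"
    using i ts assms(2,4) by (intro assms(6)) (auto simp del: in_hom intro: eval_hom[of \<Theta> n])
  finally show ?case
    using i by simp
qed simp

section \<open>The interpretation functor\<close>

primrec E_prod :: "nat list \<Rightarrow> 'o" where
  "E_prod [] = One C"
| "E_prod (m # ms) = Prd C (E m) (E_prod ms)"

primrec E_proj :: "nat list \<Rightarrow> nat \<Rightarrow> 'a" where
  "E_proj [] i = undefined"
| "E_proj (m # ms) i = (case i of 0 \<Rightarrow> Fst C (E m) (E_prod ms) | Suc j \<Rightarrow> E_proj ms j \<cdot> Snd C (E m) (E_prod ms))"

lemma E_prod_obj [simp]: "E_prod ms \<in> Obj C"
  by (induction ms) auto

lemma E_proj_arr [simp]: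
  assumes "i < length ms"
  shows "E_proj ms i \<in> Arr C" "Dom C (E_proj ms i) = E_prod ms" "Cod C (E_proj ms i) = E (ms ! i)"
proof -
  have "E_proj ms i \<in> hom C (E_prod ms) (E (ms ! i))"
    using assms by (induction ms arbitrary: i) (auto split: nat.splits)
  then show "E_proj ms i \<in> Arr C" "Dom C (E_proj ms i) = E_prod ms" "Cod C (E_proj ms i) = E (ms ! i)"
    by auto
qed

lemma E_prod_tuple:
  assumes "x \<in> Obj C" "\<And>i. i < length ms \<Longrightarrow> f i \<in> hom C x (E (ms ! i))"
  obtains h where "h \<in> hom C x (E_prod ms)" "\<And>i. i < length ms \<Longrightarrow> E_proj ms i \<cdot> h = f i"
proof -
  have "\<exists>h. h \<in> hom C x (E_prod ms) \<and> (\<forall>i < length ms. E_proj ms i \<cdot> h = f i)"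
    using assms(2)
  proof (induction ms arbitrary: f)
    case Nil
    show ?case using assms(1) by (auto intro: exI[of _ "bang C x"])
  next
    case (Cons m ms)
    have "\<exists>h. h \<in> hom C x (E_prod ms) \<and> (\<forall>i < length ms. E_proj ms i \<cdot> h = f (Suc i))"
      using Cons.prems[of "Suc i" for i] by (intro Cons.IH) auto
    then obtain h where h: "h \<in> hom C x (E_prod ms)" "\<forall>i < length ms. E_proj ms i \<cdot> h = f (Suc i)"
      by blast
    with Cons.prems[of 0] show ?case
      by (auto intro!: exI[of _ "pairing C (f 0) h"] split: nat.splits)
  qed
  with that show ?thesis by blast
qed

lemma E_prod_ext:
  assumes "h \<in> hom C x (E_prod ms)" "k \<in> hom C x (E_prod ms)"
    and "\<And>i. i < length ms \<Longrightarrow> E_proj ms i \<cdot> h = E_proj ms i \<cdot> k"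
  shows "h = k"
  using assms
proof (induction ms arbitrary: h k)
  case Nil
  then show ?case by (auto intro: one_ext)
next
  case (Cons m ms)
  show ?case
  proof (rule pairing_ext[of _ x "E m" "E_prod ms"])
    show "Snd C (E m) (E_prod ms) \<cdot> h = Snd C (E m) (E_prod ms) \<cdot> k"
      by (rule Cons.IH) (use Cons.prems(1,2) Cons.prems(3)[of "Suc i" for i] in auto)
  qed (use Cons.prems(1,2) Cons.prems(3)[of 0] in auto)
qed

text \<open>\<open>realises ms n t f\<close> says that \<open>f\<close> represents the operation sending the values of the metavariables
  in \<open>ms\<close> and of the \<open>n\<close> variables to the value of \<open>t\<close>.\<close>

definition realises :: "nat list \<Rightarrow> nat \<Rightarrow> trm \<Rightarrow> 'a \<Rightarrow> bool" where
  "realises ms n t f \<longleftrightarrow> f \<in> hom C (E_prod ms) (E n) \<and>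
    (\<forall>x k \<sigma>. k \<in> hom C x (E_prod ms) \<longrightarrow> (\<forall>i < n. \<sigma> i \<in> hom C x (E 0)) \<longrightarrow>
      app n (f \<cdot> k) \<sigma> = eval (\<lambda>i. E_proj ms i \<cdot> k) \<sigma> t)"

lemma realisesD:
  assumes "realises ms n t f"
  shows "f \<in> hom C (E_prod ms) (E n)"
    and "\<And>x k \<sigma>. k \<in> hom C x (E_prod ms) \<Longrightarrow> \<forall>i < n. \<sigma> i \<in> hom C x (E 0) \<Longrightarrow>
      app n (f \<cdot> k) \<sigma> = eval (\<lambda>i. E_proj ms i \<cdot> k) \<sigma> t"
  using assms unfolding realises_def by blast+

lemma realises_ex:
  assumes t: "elementary ms n t"
  shows "\<exists>f. realises ms n t f"
proof -
  have "\<exists>f \<in> hom C (E_prod ms) (E n). \<forall>x k \<sigma>. k \<in> hom C x (E_prod ms) \<longrightarrow>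
      (\<forall>i < n. \<sigma> i \<in> hom C x (E 0)) \<longrightarrow> app n (f \<cdot> k) \<sigma> = eval (\<lambda>i. E_proj ms i \<cdot> k) \<sigma> t"
  proof (rule app_abstraction)
    fix x k \<sigma> assume k: "k \<in> hom C x (E_prod ms)" and \<sigma>: "\<forall>i < n. \<sigma> i \<in> hom C x (E 0)"
    show "eval (\<lambda>i. E_proj ms i \<cdot> k) \<sigma> t \<in> hom C x (E 0)"
      by (rule eval_hom[OF t]) (use k \<sigma> in auto)
    fix y l assume l: "l \<in> hom C y x"
    have "eval (\<lambda>i. E_proj ms i \<cdot> k) \<sigma> t \<cdot> l = eval (\<lambda>i. (E_proj ms i \<cdot> k) \<cdot> l) (\<lambda>i. \<sigma> i \<cdot> l) t"
      by (rule eval_comp[OF t]) (use k \<sigma> l in auto)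
    also have "\<dots> = eval (\<lambda>i. E_proj ms i \<cdot> (k \<cdot> l)) (\<lambda>i. \<sigma> i \<cdot> l) t"
      by (rule eval_cong[OF t]) (use k l in auto)
    finally show "eval (\<lambda>i. E_proj ms i \<cdot> k) \<sigma> t \<cdot> l = eval (\<lambda>i. E_proj ms i \<cdot> (k \<cdot> l)) (\<lambda>i. \<sigma> i \<cdot> l) t" .
  next
    fix h and \<sigma> \<sigma>' :: "nat \<Rightarrow> 'a" assume "\<And>i. i < n \<Longrightarrow> \<sigma> i = \<sigma>' i"
    then show "eval (\<lambda>i. E_proj ms i \<cdot> h) \<sigma> t = eval (\<lambda>i. E_proj ms i \<cdot> h) \<sigma>' t"
      by (intro eval_cong[OF t]) auto
  qed simp
  then show ?thesis
    unfolding realises_def by blast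
qed

lemma realises_unique:
  assumes "realises ms n t f" "realises ms n t g"
  shows "f = g"
proof (rule app_ext)
  fix x k \<sigma> assume "k \<in> hom C x (E_prod ms)" "\<forall>i < n. \<sigma> i \<in> hom C x (E 0)"
  then show "app n (f \<cdot> k) \<sigma> = app n (g \<cdot> k) \<sigma>"
    using assms[THEN realisesD(2)] by metis
qed (use assms[THEN realisesD(1)] in blast)+

definition interprets :: "nat list \<Rightarrow> trm list \<Rightarrow> nat list \<Rightarrow> 'a \<Rightarrow> bool" where
  "interprets ms ts ns h \<longleftrightarrow> h \<in> hom C (E_prod ms) (E_prod ns) \<and>
    (\<forall>j < length ns. realises ms (ns ! j) (ts ! j) (E_proj ns j \<cdot> h))"

lemma interprets_ex:
  assumes "(ms, ts, ns) \<in> Arr MM"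
  shows "\<exists>h. interprets ms ts ns h"
proof -
  have "\<forall>j. \<exists>f. j < length ns \<longrightarrow> realises ms (ns ! j) (ts ! j) f"
    using assms realises_ex by simp
  from choice[OF this] obtain f where f: "\<And>j. j < length ns \<Longrightarrow> realises ms (ns ! j) (ts ! j) (f j)"
    by blast
  obtain h where h: "h \<in> hom C (E_prod ms) (E_prod ns)" "\<And>j. j < length ns \<Longrightarrow> E_proj ns j \<cdot> h = f j"
    using E_prod_tuple[OF E_prod_obj realisesD(1)[OF f]] by blast
  with f have "interprets ms ts ns h"
    unfolding interprets_def by metis
  then show ?thesis ..
qed

lemma interprets_unique:
  assumes "interprets ms ts ns h" "interprets ms ts ns h'"
  shows "h = h'"
proof (rule E_prod_ext)
  show "h \<in> hom C (E_prod ms) (E_prod ns)" "h' \<in> hom C (E_prod ms) (E_prod ns)"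
    using assms unfolding interprets_def by blast+
  fix j assume "j < length ns"
  then show "E_proj ns j \<cdot> h = E_proj ns j \<cdot> h'"
    using assms realises_unique unfolding interprets_def by blast
qed

definition sem :: "(nat list, marr, 'o, 'a) ftor" where
  "sem = \<lparr>FO = E_prod, FA = (\<lambda>(ms, ts, ns). THE h. interprets ms ts ns h)\<rparr>"

lemma FO_sem [simp]: "FO sem = E_prod"
  by (simp add: sem_def)

lemma interprets_sem:
  assumes "(ms, ts, ns) \<in> Arr MM"
  shows "interprets ms ts ns (FA sem (ms, ts, ns))"
  unfolding sem_def using interprets_ex[OF assms] interprets_unique by (auto intro: theI)

lemma sem_eqI: "(ms, ts, ns) \<in> Arr MM \<Longrightarrow> interprets ms ts ns h \<Longrightarrow> FA sem (ms, ts, ns) = h"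
  using interprets_sem interprets_unique by blast

lemma sem_hom: "(ms, ts, ns) \<in> Arr MM \<Longrightarrow> FA sem (ms, ts, ns) \<in> hom C (E_prod ms) (E_prod ns)"
  using interprets_sem by (auto simp: interprets_def)

lemma app_sem:
  assumes f: "(ms, ts, ns) \<in> Arr MM" and j: "j < length ns" and k: "k \<in> hom C x (E_prod ms)"
    and \<sigma>: "\<forall>i < ns ! j. \<sigma> i \<in> hom C x (E 0)"
  shows "app (ns ! j) (E_proj ns j \<cdot> (FA sem (ms, ts, ns) \<cdot> k)) \<sigma> = eval (\<lambda>i. E_proj ms i \<cdot> k) \<sigma> (ts ! j)"
proof -
  have "realises ms (ns ! j) (ts ! j) (E_proj ns j \<cdot> FA sem (ms, ts, ns))"
    using interprets_sem[OF f] j unfolding interprets_def by blast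
  from realisesD(2)[OF this k \<sigma>] show ?thesis
    using sem_hom[OF f] j k by simp
qed

lemma eval_gen: "eval \<rho> \<sigma> (gen i m) = app m (\<rho> i) \<sigma>"
  unfolding gen_def by (auto intro: app_cong)

lemma sem_Idt: "FA sem (Idt MM ms) = Idt C (E_prod ms)"
proof -
  have "interprets ms (map (\<lambda>i. gen i (ms ! i)) [0..<length ms]) ms (Idt C (E_prod ms))"
    unfolding interprets_def realises_def by (simp add: eval_gen)
  then show ?thesis by (simp add: sem_eqI)
qed

lemma sem_Comp:
  assumes f: "(ls, ss, ms) \<in> Arr MM" and g: "(ms, ts, ns) \<in> Arr MM"
  shows "FA sem ((ms, ts, ns) \<cdot>\<^bsub>MM\<^esub> (ls, ss, ms)) = FA sem (ms, ts, ns) \<cdot> FA sem (ls, ss, ms)"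
    (is "_ = ?g \<cdot> ?f")
proof -
  have gf: "(ls, map (msubst ss) ts, ns) \<in> Arr MM"
    using f g MM.comp_arr(1)[of "(ls, ss, ms)" "(ms, ts, ns)"] by simp
  have hom: "?f \<in> hom C (E_prod ls) (E_prod ms)" "?g \<in> hom C (E_prod ms) (E_prod ns)"
    using f g sem_hom by blast+
  have "realises ls (ns ! j) (map (msubst ss) ts ! j) (E_proj ns j \<cdot> (?g \<cdot> ?f))" if j: "j < length ns" for j
    unfolding realises_def
  proof (intro conjI allI impI)
    fix x k \<sigma> assume k: "k \<in> hom C x (E_prod ls)" and \<sigma>: "\<forall>i < ns ! j. \<sigma> i \<in> hom C x (E 0)"
    have fk: "?f \<cdot> k \<in> hom C x (E_prod ms)" using hom k by simp
    have "(E_proj ns j \<cdot> (?g \<cdot> ?f)) \<cdot> k = E_proj ns j \<cdot> (?g \<cdot> (?f \<cdot> k))"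
      using hom k j by simp
    then have "app (ns ! j) ((E_proj ns j \<cdot> (?g \<cdot> ?f)) \<cdot> k) \<sigma> = eval (\<lambda>i. E_proj ms i \<cdot> (?f \<cdot> k)) \<sigma> (ts ! j)"
      using app_sem[OF g j fk \<sigma>] by simp
    also have "\<dots> = eval (\<lambda>i. E_proj ls i \<cdot> k) \<sigma> (msubst ss (ts ! j))"
    proof (rule eval_msubst[symmetric, OF _ \<sigma>])
      show "elementary ms (ns ! j) (ts ! j)" using g j by simp
      show "\<forall>i < length ls. E_proj ls i \<cdot> k \<in> hom C x (E (ls ! i))" using k by simp
      show "\<forall>i < length ms. E_proj ms i \<cdot> (?f \<cdot> k) \<in> hom C x (E (ms ! i))" using fk by simp
      show "\<forall>i < length ms. elementary ls (ms ! i) (ss ! i)" using f by simp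
      show "eval (\<lambda>i. E_proj ls i \<cdot> k) \<tau> (ss ! i) = app (ms ! i) (E_proj ms i \<cdot> (?f \<cdot> k)) \<tau>"
        if "i < length ms" "\<forall>j < ms ! i. \<tau> j \<in> hom C x (E 0)" for i \<tau>
        using app_sem[OF f that(1) k that(2)] by simp
    qed
    finally show "app (ns ! j) ((E_proj ns j \<cdot> (?g \<cdot> ?f)) \<cdot> k) \<sigma> =
        eval (\<lambda>i. E_proj ls i \<cdot> k) \<sigma> (map (msubst ss) ts ! j)"
      using g j by simp
  qed (use hom j in simp)
  then have "interprets ls (map (msubst ss) ts) ns (?g \<cdot> ?f)"
    unfolding interprets_def using hom by simp
  from sem_eqI[OF gf this] show ?thesis by simp
qed

lemma is_functor_sem: "is_functor MM C sem"
  unfolding is_functor_def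
proof (intro conjI ballI impI)
  fix f assume "f \<in> Arr MM"
  then show "FA sem f \<in> hom C (FO sem (Dom MM f)) (FO sem (Cod MM f))"
    using sem_hom by (cases f) auto
next
  fix f g assume "f \<in> Arr MM" "g \<in> Arr MM" "Dom MM g = Cod MM f"
  then show "FA sem (g \<cdot>\<^bsub>MM\<^esub> f) = FA sem g \<cdot> FA sem f"
    using sem_Comp by (cases f, cases g) (auto simp del: MM_simps(2,6))
qed (use sem_Idt in auto)

text \<open>Two arrows into \<open>E n\<close> that realise the same term are equal; here the term is a generic one, realised by a
  projection.\<close>

lemma E_proj_sem:
  assumes "(ms, ts, ns) \<in> Arr MM" "j < length ns" "ts ! j = gen i (ns ! j)"
  shows "E_proj ns j \<cdot> FA sem (ms, ts, ns) = E_proj ms i"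
proof -
  have i: "i < length ms" "ms ! i = ns ! j" using assms by auto
  note hom = sem_hom[OF assms(1)]
  show ?thesis
  proof (rule app_ext)
    fix x k \<sigma> assume k: "k \<in> hom C x (E_prod ms)" and \<sigma>: "\<forall>i < ns ! j. \<sigma> i \<in> hom C x (E 0)"
    then show "app (ns ! j) ((E_proj ns j \<cdot> FA sem (ms, ts, ns)) \<cdot> k) \<sigma> = app (ns ! j) (E_proj ms i \<cdot> k) \<sigma>"
      using app_sem[OF assms(1,2) k \<sigma>] hom assms by (simp add: eval_gen)
  qed (use i hom assms in auto)
qed

lemma sem_Fst:
  assumes "i < length ms"
  shows "E_proj ms i \<cdot> FA sem (Fst MM ms ns) = E_proj (ms @ ns) i"
  using assms by (simp, intro E_proj_sem) (auto simp: nth_append)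

lemma sem_Snd:
  assumes "i < length ns"
  shows "E_proj ns i \<cdot> FA sem (Snd MM ms ns) = E_proj (ms @ ns) (length ms + i)"
  using assms by (simp, intro E_proj_sem) (auto simp: nth_append)

lemma sem_proj_hom:
  "FA sem (Fst MM ms ns) \<in> hom C (E_prod (ms @ ns)) (E_prod ms)"
  "FA sem (Snd MM ms ns) \<in> hom C (E_prod (ms @ ns)) (E_prod ns)"
  unfolding MM_simps by (rule sem_hom, auto simp: nth_append simp del: in_hom)+

lemma prd_comparison_sem:
  shows "prd_comparison MM C sem ms ns \<in> hom C (E_prod (ms @ ns)) (Prd C (E_prod ms) (E_prod ns))"
    and "iso C (prd_comparison MM C sem ms ns)"
proof -
  let ?p = "FA sem (Fst MM ms ns)" and ?q = "FA sem (Snd MM ms ns)"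
  let ?c = "prd_comparison MM C sem ms ns" and ?P = "Prd C (E_prod ms) (E_prod ns)"
  note pq = sem_proj_hom[of ms ns]
  show c: "?c \<in> hom C (E_prod (ms @ ns)) ?P"
    using pq by (simp add: prd_comparison_def del: MM_simps)
  \<comment> \<open>The inverse of the comparison is assembled from the projections of the two factors.\<close>
  define f where "f i = (if i < length ms then E_proj ms i \<cdot> Fst C (E_prod ms) (E_prod ns)
    else E_proj ns (i - length ms) \<cdot> Snd C (E_prod ms) (E_prod ns))" for i
  obtain h where h: "h \<in> hom C ?P (E_prod (ms @ ns))" "\<And>i. i < length (ms @ ns) \<Longrightarrow> E_proj (ms @ ns) i \<cdot> h = f i"
    by (rule E_prod_tuple[of ?P "ms @ ns" f]) (auto simp: f_def nth_append)
  have p: "?p \<cdot> h = Fst C (E_prod ms) (E_prod ns)"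
  proof (rule E_prod_ext)
    fix i assume i: "i < length ms"
    have "E_proj ms i \<cdot> (?p \<cdot> h) = (E_proj ms i \<cdot> ?p) \<cdot> h"
      using pq h i by (simp del: MM_simps)
    then show "E_proj ms i \<cdot> (?p \<cdot> h) = E_proj ms i \<cdot> Fst C (E_prod ms) (E_prod ns)"
      unfolding sem_Fst[OF i] using h(2)[of i] i by (simp add: f_def)
  qed (use pq h in auto)
  have q: "?q \<cdot> h = Snd C (E_prod ms) (E_prod ns)"
  proof (rule E_prod_ext)
    fix i assume i: "i < length ns"
    have "E_proj ns i \<cdot> (?q \<cdot> h) = (E_proj ns i \<cdot> ?q) \<cdot> h"
      using pq h i by (simp del: MM_simps)
    then show "E_proj ns i \<cdot> (?q \<cdot> h) = E_proj ns i \<cdot> Snd C (E_prod ms) (E_prod ns)"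
      unfolding sem_Snd[OF i] using h(2)[of "length ms + i"] i by (simp add: f_def)
  qed (use pq h in auto)
  have ch: "?c \<cdot> h = Idt C ?P"
    unfolding prd_comparison_def using pq h(1) p q by (simp del: MM_simps)
  have hc: "h \<cdot> ?c = Idt C (E_prod (ms @ ns))"
  proof (rule E_prod_ext)
    fix i assume i: "i < length (ms @ ns)"
    have "E_proj (ms @ ns) i \<cdot> (h \<cdot> ?c) = f i \<cdot> ?c"
      using h(1) h(2)[OF i, symmetric] c i by simp
    also have "\<dots> = E_proj (ms @ ns) i"
    proof (cases "i < length ms")
      case True
      then show ?thesis
        unfolding f_def prd_comparison_def using pq sem_Fst[OF True] by (simp del: MM_simps)
    next
      case False
      then show ?thesis
        unfolding f_def prd_comparison_def using i pq sem_Snd[of "i - length ms" ns ms]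
        by (simp del: MM_simps)
    qed
    finally show "E_proj (ms @ ns) i \<cdot> (h \<cdot> ?c) = E_proj (ms @ ns) i \<cdot> Idt C (E_prod (ms @ ns))"
      using i by simp
  qed (use h c in auto)
  show "iso C ?c"
    using isoI[OF c h(1) hc ch] .
qed

lemma cartesian_functor_sem: "cartesian_functor MM C sem"
proof -
  have "bang C (One C) = Idt C (One C)"
    by (rule one_ext) auto
  then have "iso C (bang C (FO sem (One MM)))"
    by (simp add: isoI[of "Idt C (One C)" "One C" "One C" "Idt C (One C)"])
  then show ?thesis
    unfolding cartesian_functor_def using is_functor_sem prd_comparison_sem by blast
qed

section \<open>Preservation of the exponentiable object by the interpretation\<close>

definition sem_ev :: "nat list \<Rightarrow> 'a" where
  "sem_ev ms = FA sem (MM_ev ms) \<cdot> inv_arr C (prd_comparison MM C sem (MM_exp ms) [0])"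

lemma sem_ev_arr [simp]:
  "sem_ev ms \<in> Arr C" "Dom C (sem_ev ms) = Prd C (E_prod (MM_exp ms)) (E_prod [0])" "Cod C (sem_ev ms) = E_prod ms"
proof -
  have "FA sem (MM_ev ms) \<in> hom C (E_prod (MM_exp ms @ [0])) (E_prod ms)"
    using MM_ev_hom[of ms] sem_hom unfolding MM_ev_def by auto
  then show "sem_ev ms \<in> Arr C" "Dom C (sem_ev ms) = Prd C (E_prod (MM_exp ms)) (E_prod [0])"
    "Cod C (sem_ev ms) = E_prod ms"
    unfolding sem_ev_def using prd_comparison_sem[of "MM_exp ms" "[0]"] by auto
qed

text \<open>Componentwise, \<open>sem_ev\<close> is the evaluation of the tower: the \<open>i\<close>-th term of \<open>MM_ev ms\<close> applies the \<open>i\<close>-th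
  metavariable to the variables followed by the new argument, and \<open>app\<close> consumes this last argument
  by \<open>ev\<close>.\<close>

lemma E_proj_sem_ev:
  assumes g: "g \<in> hom C x (E_prod (MM_exp ms))" and a: "a \<in> hom C x (E_prod [0])" and i: "i < length ms"
  shows "E_proj ms i \<cdot> (sem_ev ms \<cdot> pairing C g a) = ev (ms ! i) \<cdot> pairing C (E_proj (MM_exp ms) i \<cdot> g) (E_proj [0] 0 \<cdot> a)"
proof -
  let ?c = "prd_comparison MM C sem (MM_exp ms) [0]"
  define k where "k = inv_arr C ?c \<cdot> pairing C g a"
  note pq = sem_proj_hom[of "MM_exp ms" "[0]"]
  have c: "iso C ?c" by (rule prd_comparison_sem)
  have k: "k \<in> hom C x (E_prod (MM_exp ms @ [0]))" and pg: "FA sem (Fst MM (MM_exp ms) [0]) \<cdot> k = g"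
    and pa: "FA sem (Snd MM (MM_exp ms) [0]) \<cdot> k = a"
    using iso_pairing_factor[OF pq c[unfolded prd_comparison_def] g a]
    unfolding k_def prd_comparison_def by blast+
  have prg: "E_proj (MM_exp ms @ [0]) i \<cdot> k = E_proj (MM_exp ms) i \<cdot> g"
    using sem_Fst[of i "MM_exp ms" "[0]"] pg pq i k
    by (metis assoc in_hom length_MM_exp E_proj_arr(1,2))
  have pra: "E_proj (MM_exp ms @ [0]) (length ms) \<cdot> k = E_proj [0] 0 \<cdot> a"
    using sem_Snd[of 0 "[0]" "MM_exp ms"] pa pq k
    by (metis assoc in_hom length_MM_exp E_proj_arr(1,2) add_0_right length_Cons zero_less_Suc)
  obtain ts where ev: "MM_ev ms = (MM_exp ms @ [0], ts, ms)"
      "ts ! i = Meta i (map Var [0..<ms ! i] @ [Meta (length ms) []])"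
    unfolding MM_ev_def using i by auto
  have ev_arr: "(MM_exp ms @ [0], ts, ms) \<in> Arr MM"
    using MM_ev_hom[of ms] ev by simp
  note hom = sem_hom[OF ev_arr]
  show ?thesis
  proof (rule app_ext)
    show "E_proj ms i \<cdot> (sem_ev ms \<cdot> pairing C g a) \<in> hom C x (E (ms ! i))"
      "ev (ms ! i) \<cdot> pairing C (E_proj (MM_exp ms) i \<cdot> g) (E_proj [0] 0 \<cdot> a) \<in> hom C x (E (ms ! i))"
      using g a i by auto
    fix y h \<sigma> assume h: "h \<in> hom C y x" and \<sigma>: "\<forall>j < ms ! i. \<sigma> j \<in> hom C y (E 0)"
    have kh: "k \<cdot> h \<in> hom C y (E_prod (MM_exp ms @ [0]))" using k h by auto
    have "sem_ev ms \<cdot> pairing C g a = FA sem (MM_exp ms @ [0], ts, ms) \<cdot> k"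
      unfolding sem_ev_def ev(1) k_def using hom g a prd_comparison_sem[of "MM_exp ms" "[0]"] by simp
    then have "(E_proj ms i \<cdot> (sem_ev ms \<cdot> pairing C g a)) \<cdot> h =
        E_proj ms i \<cdot> (FA sem (MM_exp ms @ [0], ts, ms) \<cdot> (k \<cdot> h))"
      using hom k i h by simp
    then have "app (ms ! i) ((E_proj ms i \<cdot> (sem_ev ms \<cdot> pairing C g a)) \<cdot> h) \<sigma> =
        eval (\<lambda>l. E_proj (MM_exp ms @ [0]) l \<cdot> (k \<cdot> h)) \<sigma> (ts ! i)"
      using app_sem[OF ev_arr i kh \<sigma>] by simp
    also have "\<dots> = app (ms ! i) (ev (ms ! i) \<cdot> pairing C (E_proj (MM_exp ms @ [0]) i \<cdot> (k \<cdot> h))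
        (E_proj (MM_exp ms @ [0]) (length ms) \<cdot> (k \<cdot> h))) \<sigma>"
      unfolding ev(2) by (auto simp: nth_append intro: app_cong)
    also have "E_proj (MM_exp ms @ [0]) i \<cdot> (k \<cdot> h) = E_proj (MM_exp ms) i \<cdot> (g \<cdot> h)"
      using arg_cong[OF prg, of "\<lambda>p. p \<cdot> h"] k h g i by simp
    also have "E_proj (MM_exp ms @ [0]) (length ms) \<cdot> (k \<cdot> h) = E_proj [0] 0 \<cdot> (a \<cdot> h)"
      using arg_cong[OF pra, of "\<lambda>p. p \<cdot> h"] k h a by (simp del: E_prod.simps E_proj.simps)
    finally show "app (ms ! i) ((E_proj ms i \<cdot> (sem_ev ms \<cdot> pairing C g a)) \<cdot> h) \<sigma> =
        app (ms ! i) ((ev (ms ! i) \<cdot> pairing C (E_proj (MM_exp ms) i \<cdot> g) (E_proj [0] 0 \<cdot> a)) \<cdot> h) \<sigma>"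
      using g a i h by (simp del: E_proj.simps)
  qed
qed

lemma iso_E_proj_single: "iso C (E_proj [m] 0)"
proof (rule isoI[where a = "E_prod [m]" and b = "E m"])
  show "pairing C (Idt C (E m)) (bang C (E m)) \<cdot> E_proj [m] 0 = Idt C (E_prod [m])"
    by (rule pairing_ext[of _ "E_prod [m]" "E m" "One C"]) (auto intro: one_ext)
qed auto

text \<open>Up to the isomorphism between \<open>E_prod [0]\<close> and \<open>E 0\<close> this is the fact that a finite product of
  exponentials is an exponential of the product, checked in each component with \<open>E_proj_sem_ev\<close>.\<close>

lemma sem_ev_exponential: "is_exponential C (E_prod [0]) (E_prod ms) (E_prod (MM_exp ms)) (sem_ev ms)"
proof (rule is_exponentialI)
  let ?\<iota> = "E_proj [0] 0"
  have \<iota>: "iso C ?\<iota>" "?\<iota> \<in> hom C (E_prod [0]) (E 0)"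
    using iso_E_proj_single by (auto simp del: E_prod.simps E_proj.simps)
  fix x f assume x: "x \<in> Obj C" and f: "f \<in> hom C (Prd C x (E_prod [0])) (E_prod ms)"
  let ?j = "prd_arr C (Idt C x) (inv_arr C ?\<iota>)"
  have j: "?j \<in> hom C (Prd C x (E 0)) (Prd C x (E_prod [0]))"
    using x \<iota> by simp
  have "\<exists>g. g \<in> hom C x (E (Suc (ms ! i))) \<and> (\<forall>y h k. h \<in> hom C y x \<longrightarrow> k \<in> hom C y (E 0) \<longrightarrow>
      ev (ms ! i) \<cdot> pairing C (g \<cdot> h) k = (E_proj ms i \<cdot> (f \<cdot> ?j)) \<cdot> pairing C h k)"
    (is "\<exists>g. ?P i g") if i: "i < length ms" for i
  proof -
    have "E_proj ms i \<cdot> (f \<cdot> ?j) \<in> hom C (Prd C x (E 0)) (E (ms ! i))"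
      using f i j by simp
    then show ?thesis by (rule exp_curry[OF E_exp E_obj x]) blast
  qed
  then have "\<forall>i. \<exists>g. i < length ms \<longrightarrow> ?P i g" by blast
  from choice[OF this] obtain G where P: "\<forall>i. i < length ms \<longrightarrow> ?P i (G i)" by (rule exE)
  have G: "\<And>i. i < length ms \<Longrightarrow> G i \<in> hom C x (E (Suc (ms ! i)))"
    "\<And>i y h k. i < length ms \<Longrightarrow> h \<in> hom C y x \<Longrightarrow> k \<in> hom C y (E 0) \<Longrightarrow>
      ev (ms ! i) \<cdot> pairing C (G i \<cdot> h) k = (E_proj ms i \<cdot> (f \<cdot> ?j)) \<cdot> pairing C h k"
    using P by blast+
  obtain g where g: "g \<in> hom C x (E_prod (MM_exp ms))" "\<And>i. i < length ms \<Longrightarrow> E_proj (MM_exp ms) i \<cdot> g = G i"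
    by (rule E_prod_tuple[of x "MM_exp ms" G]) (use x G(1) in auto)
  have "sem_ev ms \<cdot> pairing C (g \<cdot> h) k = f \<cdot> pairing C h k"
    if h: "h \<in> hom C y x" and k: "k \<in> hom C y (E_prod [0])" for y h k
  proof (rule E_prod_ext)
    fix i assume i: "i < length ms"
    have "E_proj ms i \<cdot> (sem_ev ms \<cdot> pairing C (g \<cdot> h) k) =
        ev (ms ! i) \<cdot> pairing C (E_proj (MM_exp ms) i \<cdot> (g \<cdot> h)) (?\<iota> \<cdot> k)"
      by (rule E_proj_sem_ev) (use g h k i in auto)
    also have "E_proj (MM_exp ms) i \<cdot> (g \<cdot> h) = G i \<cdot> h"
      using g(1) g(2)[OF i, symmetric] h i by simp
    also have "ev (ms ! i) \<cdot> pairing C \<dots> (?\<iota> \<cdot> k) = (E_proj ms i \<cdot> (f \<cdot> ?j)) \<cdot> pairing C h (?\<iota> \<cdot> k)"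
      by (rule G(2)[OF i h]) (use \<iota> k in \<open>auto simp del: E_prod.simps E_proj.simps\<close>)
    also have "\<dots> = E_proj ms i \<cdot> (f \<cdot> pairing C h k)"
      using \<iota> f i h k x by (simp del: E_prod.simps E_proj.simps)
    finally show "E_proj ms i \<cdot> (sem_ev ms \<cdot> pairing C (g \<cdot> h) k) = E_proj ms i \<cdot> (f \<cdot> pairing C h k)" .
  qed (use f g h k in auto)
  with g(1) show "\<exists>g \<in> hom C x (E_prod (MM_exp ms)). \<forall>y h k. h \<in> hom C y x \<longrightarrow> k \<in> hom C y (E_prod [0]) \<longrightarrow>
      sem_ev ms \<cdot> pairing C (g \<cdot> h) k = f \<cdot> pairing C h k" by blast
next
  let ?\<iota> = "E_proj [0] 0"
  have \<iota>: "iso C ?\<iota>" "?\<iota> \<in> hom C (E_prod [0]) (E 0)"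
    using iso_E_proj_single by (auto simp del: E_prod.simps E_proj.simps)
  fix x g g' assume g: "g \<in> hom C x (E_prod (MM_exp ms))" "g' \<in> hom C x (E_prod (MM_exp ms))"
    and eq: "\<And>y h k. h \<in> hom C y x \<Longrightarrow> k \<in> hom C y (E_prod [0]) \<Longrightarrow>
      sem_ev ms \<cdot> pairing C (g \<cdot> h) k = sem_ev ms \<cdot> pairing C (g' \<cdot> h) k"
  show "g = g'"
  proof (rule E_prod_ext[OF g])
    fix i assume "i < length (MM_exp ms)"
    then have i: "i < length ms" by simp
    show "E_proj (MM_exp ms) i \<cdot> g = E_proj (MM_exp ms) i \<cdot> g'"
    proof (rule exp_ext[OF E_exp E_obj])
      fix y h k assume h: "h \<in> hom C y x" and k: "k \<in> hom C y (E 0)"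
      let ?k = "inv_arr C ?\<iota> \<cdot> k"
      have k': "?k \<in> hom C y (E_prod [0])" "?\<iota> \<cdot> ?k = k"
        using k \<iota> by (auto simp del: E_prod.simps E_proj.simps)
      have *: "ev (ms ! i) \<cdot> pairing C ((E_proj (MM_exp ms) i \<cdot> p) \<cdot> h) k =
          E_proj ms i \<cdot> (sem_ev ms \<cdot> pairing C (p \<cdot> h) ?k)" if "p \<in> hom C x (E_prod (MM_exp ms))" for p
        using E_proj_sem_ev[of "p \<cdot> h" y ms ?k i] that h k' i by simp
      show "ev (ms ! i) \<cdot> pairing C ((E_proj (MM_exp ms) i \<cdot> g) \<cdot> h) k =
          ev (ms ! i) \<cdot> pairing C ((E_proj (MM_exp ms) i \<cdot> g') \<cdot> h) k"
        unfolding *[OF g(1)] *[OF g(2)] eq[OF h k'(1)] ..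
    qed (use g i in auto)
  qed
qed auto

end

lemma exponential_tower_ex:
  assumes "cartesian_category C" "exponentiable C D"
  obtains E ev where "E 0 = D" "exponential_tower C E ev"
proof -
  interpret cartesian_category C by fact
  have "\<forall>b. \<exists>e. b \<in> Obj C \<longrightarrow> (\<exists>ev. is_exponential C D b e ev)"
    using assms(2) unfolding exponentiable_def by blast
  then obtain X where X: "\<And>b. b \<in> Obj C \<Longrightarrow> \<exists>ev. is_exponential C D b (X b) ev"
    by metis
  define E where "E m = (X ^^ m) D" for m
  have obj: "E m \<in> Obj C" for m
    by (induction m) (use assms(2) X exp_arr(1) in \<open>auto simp: E_def exponentiable_def, blast\<close>)
  then have "\<forall>m. \<exists>ev. is_exponential C D (E m) (E (Suc m)) ev"
    using X unfolding E_def by simp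
  then obtain ev where "\<And>m. is_exponential C D (E m) (E (Suc m)) (ev m)"
    by metis
  moreover have "E 0 = D" by (simp add: E_def)
  ultimately have "exponential_tower C E ev"
    using obj[of 0] by unfold_locales simp_all
  with \<open>E 0 = D\<close> show ?thesis by (rule that)
qed

lemma cartesian_functor_ex:
  assumes C: "cartesian_category C" and D: "exponentiable C D"
  shows "\<exists>I. cartesian_functor MM C I \<and> preserves_exponentiable MM [0] MM_exp MM_ev C I \<and>
    isomorphic C (FO I [0]) D"
proof -
  obtain E ev where E: "E 0 = D" and "exponential_tower C E ev"
    using exponential_tower_ex[OF C D] .
  then interpret exponential_tower C E ev by simp
  have \<iota>: "iso C (E_proj [0] 0)" "E_proj [0] 0 \<in> hom C (E_prod [0]) D"
    using iso_E_proj_single E by (auto simp del: E_prod.simps E_proj.simps)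
  have "exponentiable C (E_prod [0])"
    unfolding exponentiable_def
    using D exponential_transport[OF _ \<iota>] unfolding exponentiable_def
    by (metis E_prod_obj)
  moreover have "iso C (mate C (E_prod [0]) e' ev' (E_prod (MM_exp ms)) (sem_ev ms))"
    if "is_exponential C (E_prod [0]) (E_prod ms) e' ev'" for ms e' ev'
    by (rule mate_iso_if_exponential[OF sem_ev_exponential that E_prod_obj])
  ultimately have "preserves_exponentiable MM [0] MM_exp MM_ev C sem"
    unfolding preserves_exponentiable_def sem_ev_def by simp
  moreover have "isomorphic C (FO sem [0]) D"
    unfolding isomorphic_def FO_sem using \<iota> by blast
  ultimately show ?thesis
    using cartesian_functor_sem by blast
qed


section \<open>Generation of the elementary terms\<close>

lemma subst_closed: "elementary \<Theta> 0 u \<Longrightarrow> subst us u = u"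
  by (induction u rule: trm.induct) (auto intro: map_idI)

lemma elementary_subst_closed:
  assumes "elementary \<Theta> (Suc n) t" "elementary \<Theta> 0 u"
  shows "elementary \<Theta> n (subst (map Var [0..<n] @ [u]) t)"
proof (rule elementary_subst)
  show "elementary \<Theta> (length (map Var [0..<n] @ [u]) + n) t"
    using elementary_weaken_vars[OF assms(1)] by simp
  show "\<forall>v \<in> set (map Var [0..<n] @ [u]). elementary \<Theta> n v"
    using elementary_weaken_vars[OF assms(2)] by auto
qed

text \<open>The three closure conditions correspond to projections, evaluation and currying. Uncurrying
  repeatedly leaves only terms without variables. Such a term is a metavariable applied to smaller
  closed terms, hence obtained from a generic term by evaluating at one closed argument after the
  other, starting with the last.\<close>

lemma elementary_generated [consumes 1, case_names gen ev uncurry]: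
  assumes "elementary \<Theta> n t"
    and gen: "\<And>\<Theta> i. i < length \<Theta> \<Longrightarrow> Q \<Theta> (\<Theta> ! i) (gen i (\<Theta> ! i))"
    and ev: "\<And>\<Theta> n t u. elementary \<Theta> (Suc n) t \<Longrightarrow> elementary \<Theta> 0 u \<Longrightarrow> Q \<Theta> (Suc n) t \<Longrightarrow> Q \<Theta> 0 u \<Longrightarrow>
      Q \<Theta> n (subst (map Var [0..<n] @ [u]) t)"
    and uncurry: "\<And>\<Theta> n t. elementary \<Theta> (Suc n) t \<Longrightarrow> Q (\<Theta> @ [0]) n (uncurry_trm (length \<Theta>) n t) \<Longrightarrow>
      Q \<Theta> (Suc n) t"
  shows "Q \<Theta> n t"
proof -
  \<comment> \<open>Substituting \<open>u\<close> for the last variable is the evaluation step; the other arguments follow by induction.\<close>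
  have closed_args: "Q \<Theta> 0 (subst us t)"
    if "elementary \<Theta> n t" "Q \<Theta> n t" "length us = n" "\<forall>u \<in> set us. elementary \<Theta> 0 u \<and> Q \<Theta> 0 u"
    for \<Theta> n t us
    using that
  proof (induction n arbitrary: t us)
    case (Suc n)
    then obtain vs u where us: "us = vs @ [u]" "length vs = n"
      by (cases us rule: rev_cases) auto
    let ?t = "subst (map Var [0..<n] @ [u]) t"
    have u: "elementary \<Theta> 0 u" "Q \<Theta> 0 u"
      using Suc.prems(4) us by auto
    have "map (subst vs) (map Var [0..<n]) = vs"
      using us by (auto intro: nth_equalityI)
    then have "map (subst vs) (map Var [0..<n] @ [u]) = us"
      using us subst_closed[OF u(1)] by simp
    then have "subst vs ?t = subst us t"
      using Suc.prems(1) by (subst subst_subst[of \<Theta>]) simp_all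
    moreover have "Q \<Theta> 0 (subst vs ?t)"
    proof (rule Suc.IH)
      show "elementary \<Theta> n ?t" by (rule elementary_subst_closed[OF Suc.prems(1) u(1)])
      show "Q \<Theta> n ?t" by (rule ev[OF Suc.prems(1) u(1) Suc.prems(2) u(2)])
    qed (use us Suc.prems(4) in auto)
    ultimately show ?case by simp
  qed simp
  have closed: "Q \<Theta> 0 t" if "elementary \<Theta> 0 t" for \<Theta> t
    using that
  proof (induction t rule: trm.induct)
    case (Meta i ts)
    then have "i < length \<Theta>" "length ts = \<Theta> ! i" "\<forall>t \<in> set ts. elementary \<Theta> 0 t \<and> Q \<Theta> 0 t"
      by auto
    then have "Q \<Theta> 0 (subst ts (gen i (\<Theta> ! i)))"
      by (intro closed_args[OF _ gen]) auto
    then show ?case using \<open>length ts = \<Theta> ! i\<close> by simp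
  qed simp
  show ?thesis
    using assms(1)
  proof (induction n arbitrary: \<Theta> t)
    case 0
    then show ?case by (rule closed)
  next
    case (Suc n)
    show ?case
      by (rule uncurry[OF Suc.prems Suc.IH[OF elementary_uncurry_trm[OF Suc.prems]]])
  qed
qed

section \<open>Functors out of the theory of equality\<close>

definition single :: "nat list \<Rightarrow> nat \<Rightarrow> trm \<Rightarrow> marr" where
  "single \<Theta> n t = (\<Theta>, [t], [n])"

lemma single_hom: "single \<Theta> n t \<in> hom MM \<Theta> [n] \<longleftrightarrow> elementary \<Theta> n t"
  by (simp add: single_def)

definition proj :: "nat list \<Rightarrow> nat \<Rightarrow> marr" where
  "proj ms i = single ms (ms ! i) (gen i (ms ! i))"

lemma proj_hom: "i < length ms \<Longrightarrow> proj ms i \<in> hom MM ms [ms ! i]"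
  by (simp add: proj_def single_hom del: in_hom)

lemma proj_comp:
  assumes "(ms, ts, ns) \<in> Arr MM" "j < length ns"
  shows "proj ns j \<cdot>\<^bsub>MM\<^esub> (ms, ts, ns) = single ms (ns ! j) (ts ! j)"
  using assms msubst_gen[of ms "ns ! j" ts j] by (simp add: proj_def single_def)

lemma proj_Snd: "i < length ms \<Longrightarrow> proj ms i \<cdot>\<^bsub>MM\<^esub> Snd MM [m] ms = proj (m # ms) (Suc i)"
  by (subst MM_simps(10), subst proj_comp) (simp_all add: proj_def)

lemma Fst_eq_proj: "Fst MM [m] ms = proj (m # ms) 0"
  by (simp add: proj_def single_def)

lemma Fst_hom_MM: "Fst MM ms ns \<in> hom MM (ms @ ns) ms" and Snd_hom_MM: "Snd MM ms ns \<in> hom MM (ms @ ns) ns"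
  using MM.fst_hom[of ms ns] MM.snd_hom[of ms ns] by (simp_all only: MM_simps UNIV_I)

locale MM_functor = cartesian_category C
  for C :: "('o, 'a, 'z) ccat_scheme" (structure) +
  fixes F :: "(nat list, marr, 'o, 'a) ftor"
  assumes cartesian: "cartesian_functor MM C F"
    and preserves: "preserves_exponentiable MM [0] MM_exp MM_ev C F"
begin

lemma F_obj [simp]: "FO F ms \<in> Obj C"
  using cartesian unfolding cartesian_functor_def is_functor_def by simp

lemma F_hom: "f \<in> hom MM ms ns \<Longrightarrow> FA F f \<in> hom C (FO F ms) (FO F ns)"
  using cartesian unfolding cartesian_functor_def is_functor_def by auto

lemma F_comp: "f \<in> hom MM ls ms \<Longrightarrow> g \<in> hom MM ms ns \<Longrightarrow> FA F (g \<cdot>\<^bsub>MM\<^esub> f) = FA F g \<cdot> FA F f"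
  using cartesian unfolding cartesian_functor_def is_functor_def by (simp del: MM_simps)

lemmas F_Fst_Snd = F_hom[OF Fst_hom_MM] F_hom[OF Snd_hom_MM]

lemma F_comparison: "iso C (pairing C (FA F (Fst MM ms ns)) (FA F (Snd MM ms ns)))"
  using cartesian unfolding cartesian_functor_def prd_comparison_def by simp

lemmas F_pair = iso_pairing_factor[OF F_Fst_Snd F_comparison]
lemmas F_pair_ext = iso_pairing_ext[OF F_Fst_Snd F_comparison]

definition F_proj :: "nat list \<Rightarrow> nat \<Rightarrow> 'a" where
  "F_proj ms i = FA F (proj ms i)"

lemma F_proj_hom: "i < length ms \<Longrightarrow> F_proj ms i \<in> hom C (FO F ms) (FO F [ms ! i])"
  unfolding F_proj_def by (intro F_hom proj_hom)

lemma F_proj_arr [simp]: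
  assumes "i < length ms"
  shows "F_proj ms i \<in> Arr C" "Dom C (F_proj ms i) = FO F ms" "Cod C (F_proj ms i) = FO F [ms ! i]"
  using F_proj_hom[OF assms] by auto

lemma F_proj_Suc:
  assumes "i < length ms"
  shows "F_proj (m # ms) (Suc i) = F_proj ms i \<cdot> FA F (Snd MM [m] ms)"
  unfolding F_proj_def by (simp only: F_comp[OF Snd_hom_MM proj_hom[OF assms]] flip: proj_Snd[OF assms, of m])

lemma F_proj_comp:
  assumes "(ms, ts, ns) \<in> Arr MM" "j < length ns"
  shows "F_proj ns j \<cdot> FA F (ms, ts, ns) = FA F (single ms (ns ! j) (ts ! j))"
proof -
  have "(ms, ts, ns) \<in> hom MM ms ns" using assms by simp
  from F_comp[OF this proj_hom[OF assms(2)]] show ?thesis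
    unfolding F_proj_def proj_comp[OF assms] by simp
qed

text \<open>This lemma and the next say that \<open>F ms\<close> is a product of the objects \<open>F [m]\<close> for \<open>m\<close> in \<open>ms\<close>.\<close>

lemma cone_ext:
  assumes "h \<in> hom C x (FO F ms)" "k \<in> hom C x (FO F ms)"
    and "\<And>i. i < length ms \<Longrightarrow> F_proj ms i \<cdot> h = F_proj ms i \<cdot> k"
  shows "h = k"
  using assms
proof (induction ms arbitrary: h k)
  case Nil
  have i: "iso C (bang C (FO F []))"
    using cartesian unfolding cartesian_functor_def by simp
  have "bang C (FO F []) \<cdot> h = bang C (FO F []) \<cdot> k"
    by (rule one_ext) (use Nil in simp_all)
  then have "inv_arr C (bang C (FO F [])) \<cdot> (bang C (FO F []) \<cdot> h) =
      inv_arr C (bang C (FO F [])) \<cdot> (bang C (FO F []) \<cdot> k)" by simp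
  then show ?case using Nil i by simp
next
  case (Cons m ms)
  let ?p = "FA F (Fst MM [m] ms)" and ?q = "FA F (Snd MM [m] ms)"
  have pq: "?p \<in> hom C (FO F (m # ms)) (FO F [m])" "?q \<in> hom C (FO F (m # ms)) (FO F ms)"
    using F_Fst_Snd[of "[m]" ms] by (simp_all del: MM_simps)
  have hk: "h \<in> hom C x (FO F ([m] @ ms))" "k \<in> hom C x (FO F ([m] @ ms))"
    using Cons.prems by simp_all
  have "?p \<cdot> h = ?p \<cdot> k"
    using Cons.prems(3)[of 0] unfolding F_proj_def Fst_eq_proj by simp
  moreover have "?q \<cdot> h = ?q \<cdot> k"
  proof (rule Cons.IH)
    fix i assume i: "i < length ms"
    then have "(F_proj ms i \<cdot> ?q) \<cdot> h = (F_proj ms i \<cdot> ?q) \<cdot> k"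
      using Cons.prems(3)[of "Suc i"] unfolding F_proj_Suc[OF i] by simp
    then show "F_proj ms i \<cdot> (?q \<cdot> h) = F_proj ms i \<cdot> (?q \<cdot> k)"
      using i pq Cons.prems(1,2) by (simp del: MM_simps)
  qed (use pq Cons.prems(1,2) in \<open>simp_all del: MM_simps\<close>)
  ultimately show ?case
    by (rule F_pair_ext[OF hk])
qed

lemma cone_tuple:
  assumes "x \<in> Obj C" "\<And>i. i < length ms \<Longrightarrow> f i \<in> hom C x (FO F [ms ! i])"
  shows "\<exists>h. h \<in> hom C x (FO F ms) \<and> (\<forall>i < length ms. F_proj ms i \<cdot> h = f i)"
  using assms(2)
proof (induction ms arbitrary: f)
  case Nil
  have "iso C (bang C (FO F []))"
    using cartesian unfolding cartesian_functor_def by simp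
  then have "inv_arr C (bang C (FO F [])) \<cdot> bang C x \<in> hom C x (FO F [])"
    using assms(1) by simp
  then show ?case by auto
next
  case (Cons m ms)
  have "\<exists>h. h \<in> hom C x (FO F ms) \<and> (\<forall>i < length ms. F_proj ms i \<cdot> h = f (Suc i))"
    using Cons.prems[of "Suc i" for i] by (intro Cons.IH) auto
  then obtain h where h: "h \<in> hom C x (FO F ms)" "\<forall>i < length ms. F_proj ms i \<cdot> h = f (Suc i)"
    by blast
  have f: "f 0 \<in> hom C x (FO F [m])" using Cons.prems[of 0] by simp
  let ?p = "FA F (Fst MM [m] ms)" and ?q = "FA F (Snd MM [m] ms)"
  define k where "k = inv_arr C (pairing C ?p ?q) \<cdot> pairing C (f 0) h"
  have k: "k \<in> hom C x (FO F (m # ms))" "?p \<cdot> k = f 0" "?q \<cdot> k = h"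
    using F_pair[OF f h(1)] unfolding k_def by simp_all
  have "?q \<in> hom C (FO F (m # ms)) (FO F ms)"
    using F_Fst_Snd[of "[m]" ms] by (simp_all del: MM_simps)
  then have "F_proj (m # ms) (Suc i) \<cdot> k = f (Suc i)" if "i < length ms" for i
    unfolding F_proj_Suc[OF that] using k h that by (simp del: MM_simps)
  moreover have "F_proj (m # ms) 0 \<cdot> k = f 0"
    using k(2) unfolding F_proj_def Fst_eq_proj .
  ultimately have "F_proj (m # ms) i \<cdot> k = f i" if "i < length (m # ms)" for i
    using that by (cases i) auto
  with k(1) show ?case by blast
qed

definition Fev :: "nat \<Rightarrow> 'a" where
  "Fev n = FA F (MM_ev [n]) \<cdot> inv_arr C (prd_comparison MM C F [Suc n] [0])"

lemma Fev_hom: "Fev n \<in> hom C (Prd C (FO F [Suc n]) (FO F [0])) (FO F [n])"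
proof -
  have "MM_ev [n] \<in> hom MM ([Suc n] @ [0]) [n]"
    using MM_ev_hom[of "[n]"] by (simp add: MM_exp_def)
  from F_hom[OF this] show ?thesis
    using F_comparison[of "[Suc n]" "[0]"] F_Fst_Snd[of "[Suc n]" "[0]"]
    unfolding Fev_def prd_comparison_def by (simp del: MM_simps)
qed

lemma Fev_arr [simp]:
  "Fev n \<in> Arr C" "Dom C (Fev n) = Prd C (FO F [Suc n]) (FO F [0])" "Cod C (Fev n) = FO F [n]"
  using Fev_hom[of n] by auto

text \<open>The definition of preservation quantifies over exponentials in \<open>C\<close>; one exists by exponentiability of
  \<open>F [0]\<close>, and invertibility of its comparison arrow makes \<open>F [Suc n]\<close> an exponential.\<close>

lemma Fev_exponential: "is_exponential C (FO F [0]) (FO F [n]) (FO F [Suc n]) (Fev n)"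
proof -
  have "exponentiable C (FO F [0])"
    using preserves unfolding preserves_exponentiable_def by blast
  then obtain e ev where e: "is_exponential C (FO F [0]) (FO F [n]) e ev"
    unfolding exponentiable_def using F_obj by blast
  have "MM_exp [n] = [Suc n]" by (simp add: MM_exp_def)
  then have "iso C (mate C (FO F [0]) e ev (FO F [Suc n]) (Fev n))"
    using preserves e unfolding preserves_exponentiable_def Fev_def by (metis MM_simps(1) UNIV_I)
  then show ?thesis
    by (rule exponential_if_mate_iso[OF e F_obj F_obj Fev_hom])
qed

text \<open>Evaluating the image of \<open>t\<close> at the image of \<open>u\<close> is the image of the composite of \<open>MM_ev [n]\<close> with the
  pair of \<open>t\<close> and \<open>u\<close>, which substitutes \<open>u\<close> for the last variable of \<open>t\<close>.\<close>

lemma Fev_pairing: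
  assumes t: "elementary \<Theta> (Suc n) t" and u: "elementary \<Theta> 0 u" and k: "k \<in> hom C x (FO F \<Theta>)"
  shows "Fev n \<cdot> pairing C (FA F (single \<Theta> (Suc n) t) \<cdot> k) (FA F (single \<Theta> 0 u) \<cdot> k) =
    FA F (single \<Theta> n (subst (map Var [0..<n] @ [u]) t)) \<cdot> k"
proof -
  let ?t = "single \<Theta> (Suc n) t" and ?u = "single \<Theta> 0 u"
  let ?f = "pairing MM ?t ?u" and ?c = "prd_comparison MM C F [Suc n] [0]"
  have tu: "?t \<in> hom MM \<Theta> [Suc n]" "?u \<in> hom MM \<Theta> [0]"
    using t u by (simp_all add: single_hom del: in_hom)
  have f: "?f \<in> hom MM \<Theta> ([Suc n] @ [0])"
    using MM.pairing_arr[of ?t ?u] tu by simp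
  have pf: "Fst MM [Suc n] [0] \<cdot>\<^bsub>MM\<^esub> ?f = ?t" "Snd MM [Suc n] [0] \<cdot>\<^bsub>MM\<^esub> ?f = ?u"
    using MM.proj_pairing[of ?t ?u "[Suc n]" "[0]"] tu by (simp_all del: MM_simps)
  have ev: "MM_ev [n] \<in> hom MM ([Suc n] @ [0]) [n]"
    using MM_ev_hom[of "[n]"] by (simp add: MM_exp_def)
  note homs = F_hom[OF f] F_hom[OF ev] F_hom[OF tu(1)] F_hom[OF tu(2)] F_Fst_Snd[of "[Suc n]" "[0]"]
  have c: "iso C ?c" "?c \<in> hom C (FO F ([Suc n] @ [0])) (Prd C (FO F [Suc n]) (FO F [0]))"
    using F_comparison homs unfolding prd_comparison_def by (simp_all del: MM_simps)
  have "?c \<cdot> (FA F ?f \<cdot> k) = pairing C ((FA F (Fst MM [Suc n] [0]) \<cdot> FA F ?f) \<cdot> k)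
      ((FA F (Snd MM [Suc n] [0]) \<cdot> FA F ?f) \<cdot> k)"
    unfolding prd_comparison_def using homs k by (simp del: MM_simps)
  also have "\<dots> = pairing C (FA F ?t \<cdot> k) (FA F ?u \<cdot> k)"
    unfolding F_comp[OF f Fst_hom_MM, symmetric] F_comp[OF f Snd_hom_MM, symmetric] pf ..
  finally have "Fev n \<cdot> pairing C (FA F ?t \<cdot> k) (FA F ?u \<cdot> k) = Fev n \<cdot> (?c \<cdot> (FA F ?f \<cdot> k))"
    by simp
  also have "\<dots> = (FA F (MM_ev [n]) \<cdot> FA F ?f) \<cdot> k"
    unfolding Fev_def using c homs k by simp
  also have "FA F (MM_ev [n]) \<cdot> FA F ?f = FA F (MM_ev [n] \<cdot>\<^bsub>MM\<^esub> ?f)"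
    by (rule F_comp[OF f ev, symmetric])
  also have "MM_ev [n] \<cdot>\<^bsub>MM\<^esub> ?f = single \<Theta> n (subst (map Var [0..<n] @ [u]) t)"
    using MM_ev_comp[of \<Theta> "[t]" "[n]" u] t u by (simp add: single_def MM_exp_def)
  finally show ?thesis .
qed

end

section \<open>Comparison of two functors\<close>
locale MM_functor_pair = I: MM_functor C I + J: MM_functor C J
  for C :: "('o, 'a, 'z) ccat_scheme" (structure)
    and I J :: "(nat list, marr, 'o, 'a) ftor" +
  fixes \<theta> :: "nat \<Rightarrow> 'a"
  assumes \<theta>_iso: "iso C (\<theta> n)"
    and \<theta>_hom: "\<theta> n \<in> hom C (FO I [n]) (FO J [n])"
    and \<theta>_ev: "h \<in> hom C x (FO I [Suc n]) \<Longrightarrow> k \<in> hom C x (FO I [0]) \<Longrightarrow>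
      J.Fev n \<cdot> pairing C (\<theta> (Suc n) \<cdot> h) (\<theta> 0 \<cdot> k) = \<theta> n \<cdot> (I.Fev n \<cdot> pairing C h k)"
begin

lemma \<theta>_arr [simp]: "\<theta> n \<in> Arr C" "Dom C (\<theta> n) = FO I [n]" "Cod C (\<theta> n) = FO J [n]"
  using \<theta>_hom[of n] by auto

definition transf :: "nat list \<Rightarrow> 'a" where
  "transf ms = (SOME h. h \<in> hom C (FO I ms) (FO J ms) \<and>
    (\<forall>i < length ms. J.F_proj ms i \<cdot> h = \<theta> (ms ! i) \<cdot> I.F_proj ms i))"

lemma transf:
  "transf ms \<in> hom C (FO I ms) (FO J ms)"
  "i < length ms \<Longrightarrow> J.F_proj ms i \<cdot> transf ms = \<theta> (ms ! i) \<cdot> I.F_proj ms i"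
proof -
  have "\<exists>h. h \<in> hom C (FO I ms) (FO J ms) \<and> (\<forall>i < length ms. J.F_proj ms i \<cdot> h = \<theta> (ms ! i) \<cdot> I.F_proj ms i)"
    by (rule J.cone_tuple) simp_all
  from someI_ex[OF this] show "transf ms \<in> hom C (FO I ms) (FO J ms)"
    "i < length ms \<Longrightarrow> J.F_proj ms i \<cdot> transf ms = \<theta> (ms ! i) \<cdot> I.F_proj ms i"
    unfolding transf_def by blast+
qed

lemma transf_arr [simp]:
  "transf ms \<in> Arr C" "Dom C (transf ms) = FO I ms" "Cod C (transf ms) = FO J ms"
  using transf(1)[of ms] by auto

lemma transf_iso: "iso C (transf ms)"
proof -
  have "\<exists>h. h \<in> hom C (FO J ms) (FO I ms) \<and>
      (\<forall>i < length ms. I.F_proj ms i \<cdot> h = inv_arr C (\<theta> (ms ! i)) \<cdot> J.F_proj ms i)"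
    by (rule I.cone_tuple) (simp_all add: \<theta>_iso)
  then obtain h where h: "h \<in> hom C (FO J ms) (FO I ms)"
    "\<And>i. i < length ms \<Longrightarrow> I.F_proj ms i \<cdot> h = inv_arr C (\<theta> (ms ! i)) \<cdot> J.F_proj ms i"
    by blast
  show ?thesis
  proof (rule I.isoI)
    show "h \<cdot> transf ms = Idt C (FO I ms)"
    proof (rule I.cone_ext)
      fix i assume i: "i < length ms"
      have "I.F_proj ms i \<cdot> (h \<cdot> transf ms) = (I.F_proj ms i \<cdot> h) \<cdot> transf ms"
        using i h(1) by simp
      also have "\<dots> = inv_arr C (\<theta> (ms ! i)) \<cdot> (J.F_proj ms i \<cdot> transf ms)"
        unfolding h(2)[OF i] using i by (simp add: \<theta>_iso)
      also have "\<dots> = I.F_proj ms i"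
        unfolding transf(2)[OF i] using i by (simp add: \<theta>_iso)
      finally show "I.F_proj ms i \<cdot> (h \<cdot> transf ms) = I.F_proj ms i \<cdot> Idt C (FO I ms)"
        using i by simp
    qed (use h in simp_all)
    show "transf ms \<cdot> h = Idt C (FO J ms)"
    proof (rule J.cone_ext)
      fix i assume i: "i < length ms"
      have "J.F_proj ms i \<cdot> (transf ms \<cdot> h) = (J.F_proj ms i \<cdot> transf ms) \<cdot> h"
        using i h(1) by simp
      also have "\<dots> = \<theta> (ms ! i) \<cdot> (I.F_proj ms i \<cdot> h)"
        unfolding transf(2)[OF i] using i h(1) by simp
      also have "\<dots> = J.F_proj ms i"
        unfolding h(2)[OF i] using i by (simp add: \<theta>_iso)
      finally show "J.F_proj ms i \<cdot> (transf ms \<cdot> h) = J.F_proj ms i \<cdot> Idt C (FO J ms)"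
        using i by simp
    qed (use h in simp_all)
  qed (use h transf in blast)+
qed

definition natural_at :: "nat list \<Rightarrow> nat \<Rightarrow> trm \<Rightarrow> bool" where
  "natural_at \<Theta> n t \<longleftrightarrow> FA J (single \<Theta> n t) \<cdot> transf \<Theta> = \<theta> n \<cdot> FA I (single \<Theta> n t)"

lemma natural_at_gen:
  assumes "i < length \<Theta>"
  shows "natural_at \<Theta> (\<Theta> ! i) (gen i (\<Theta> ! i))"
  using transf(2)[OF assms] unfolding natural_at_def I.F_proj_def J.F_proj_def proj_def .

lemma natural_tuple:
  assumes f: "(ms, ts, ns) \<in> Arr MM" and nat: "\<And>j. j < length ns \<Longrightarrow> natural_at ms (ns ! j) (ts ! j)"
  shows "FA J (ms, ts, ns) \<cdot> transf ms = transf ns \<cdot> FA I (ms, ts, ns)"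
proof (rule J.cone_ext)
  have "(ms, ts, ns) \<in> hom MM ms ns" using f by simp
  note homs = I.F_hom[OF this] J.F_hom[OF this]
  show "FA J (ms, ts, ns) \<cdot> transf ms \<in> hom C (FO I ms) (FO J ns)"
    "transf ns \<cdot> FA I (ms, ts, ns) \<in> hom C (FO I ms) (FO J ns)"
    using homs by simp_all
  fix j assume j: "j < length ns"
  have "J.F_proj ns j \<cdot> (FA J (ms, ts, ns) \<cdot> transf ms) = (J.F_proj ns j \<cdot> FA J (ms, ts, ns)) \<cdot> transf ms"
    using homs j by simp
  also have "\<dots> = \<theta> (ns ! j) \<cdot> (I.F_proj ns j \<cdot> FA I (ms, ts, ns))"
    using nat[OF j] unfolding natural_at_def J.F_proj_comp[OF f j] I.F_proj_comp[OF f j] .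
  also have "\<dots> = (\<theta> (ns ! j) \<cdot> I.F_proj ns j) \<cdot> FA I (ms, ts, ns)"
    using homs j by simp
  also have "\<dots> = J.F_proj ns j \<cdot> (transf ns \<cdot> FA I (ms, ts, ns))"
    unfolding transf(2)[OF j, symmetric] using homs j by simp
  finally show "J.F_proj ns j \<cdot> (FA J (ms, ts, ns) \<cdot> transf ms) = J.F_proj ns j \<cdot> (transf ns \<cdot> FA I (ms, ts, ns))" .
qed

lemma natural_at_ev:
  assumes t: "elementary \<Theta> (Suc n) t" and u: "elementary \<Theta> 0 u"
    and nat: "natural_at \<Theta> (Suc n) t" "natural_at \<Theta> 0 u"
  shows "natural_at \<Theta> n (subst (map Var [0..<n] @ [u]) t)"
proof -
  let ?t = "single \<Theta> (Suc n) t" and ?u = "single \<Theta> 0 u"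
  let ?s = "single \<Theta> n (subst (map Var [0..<n] @ [u]) t)"
  have homs: "FA I ?t \<in> hom C (FO I \<Theta>) (FO I [Suc n])" "FA I ?u \<in> hom C (FO I \<Theta>) (FO I [0])"
    using t u by (intro I.F_hom; simp add: single_hom del: in_hom)+
  have "?s \<in> hom MM \<Theta> [n]"
    using elementary_subst_closed[OF t u] by (simp add: single_hom del: in_hom)
  note s = I.F_hom[OF this]
  have "FA J ?s \<cdot> transf \<Theta> = J.Fev n \<cdot> pairing C (FA J ?t \<cdot> transf \<Theta>) (FA J ?u \<cdot> transf \<Theta>)"
    by (rule J.Fev_pairing[OF t u transf(1), symmetric])
  also have "\<dots> = J.Fev n \<cdot> pairing C (\<theta> (Suc n) \<cdot> FA I ?t) (\<theta> 0 \<cdot> FA I ?u)"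
    using nat unfolding natural_at_def by simp
  also have "\<dots> = \<theta> n \<cdot> (I.Fev n \<cdot> pairing C (FA I ?t) (FA I ?u))"
    by (rule \<theta>_ev[OF homs])
  also have "I.Fev n \<cdot> pairing C (FA I ?t) (FA I ?u) = FA I ?s"
    using I.Fev_pairing[OF t u, of "Idt C (FO I \<Theta>)" "FO I \<Theta>"] homs s by simp
  finally show ?thesis
    unfolding natural_at_def .
qed

text \<open>Two arrows into the exponential \<open>J [Suc n]\<close> are compared by evaluating them at \<open>h\<close> and \<open>b\<close>. Since \<open>\<theta> 0\<close>
  is invertible, \<open>h\<close> and \<open>b\<close> come from one generalised element \<open>k\<close> of \<open>I (\<Theta> @ [0])\<close>, at which the
  claim is naturality at the uncurried term.\<close>

lemma natural_at_uncurry: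
  assumes t: "elementary \<Theta> (Suc n) t" and nat: "natural_at (\<Theta> @ [0]) n (uncurry_trm (length \<Theta>) n t)"
  shows "natural_at \<Theta> (Suc n) t"
proof -
  let ?\<Theta> = "\<Theta> @ [0]" and ?l = "length \<Theta>"
  let ?p = "Fst MM \<Theta> [0]" and ?q = "single ?\<Theta> 0 (Meta ?l [])"
  let ?t = "single \<Theta> (Suc n) t" and ?t' = "single ?\<Theta> (Suc n) t"
  let ?s = "single ?\<Theta> n (uncurry_trm ?l n t)"
  have t': "elementary ?\<Theta> (Suc n) t"
    using elementary_weaken[OF t order_refl] .
  have q: "elementary ?\<Theta> 0 (Meta ?l [])" by simp
  have Snd: "Snd MM \<Theta> [0] = ?q"
    by (simp add: single_def gen_def)
  have t_hom: "?t \<in> hom MM \<Theta> [Suc n]" and s_hom: "?s \<in> hom MM ?\<Theta> [n]"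
    using t elementary_uncurry_trm[OF t] by (simp_all add: single_hom del: in_hom)
  have "?t \<cdot>\<^bsub>MM\<^esub> ?p = ?t'"
    using t by (simp add: single_def) (rule msubst_gens[OF t], simp)
  then have tp: "FA I ?t \<cdot> FA I ?p = FA I ?t'" "FA J ?t \<cdot> FA J ?p = FA J ?t'"
    using I.F_comp[OF Fst_hom_MM t_hom] J.F_comp[OF Fst_hom_MM t_hom] by (metis, metis)
  have nat_p: "FA J ?p \<cdot> transf ?\<Theta> = transf \<Theta> \<cdot> FA I ?p"
  proof -
    have "natural_at ?\<Theta> (\<Theta> ! j) (gen j (\<Theta> ! j))" if "j < ?l" for j
      using natural_at_gen[of j ?\<Theta>] that by (simp add: nth_append)
    then show ?thesis
      unfolding MM_simps by (intro natural_tuple) (auto simp: nth_append)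
  qed
  have nat_q: "FA J ?q \<cdot> transf ?\<Theta> = \<theta> 0 \<cdot> FA I ?q"
    using natural_at_gen[of ?l ?\<Theta>] by (simp add: natural_at_def gen_def)
  note homs = I.F_hom[OF t_hom] J.F_hom[OF t_hom] I.F_hom[OF s_hom] J.F_hom[OF s_hom]
    I.F_Fst_Snd[of \<Theta> "[0]", unfolded Snd] J.F_Fst_Snd[of \<Theta> "[0]", unfolded Snd]
  show ?thesis
    unfolding natural_at_def
  proof (rule I.exp_ext[OF J.Fev_exponential J.F_obj])
    show "FA J ?t \<cdot> transf \<Theta> \<in> hom C (FO I \<Theta>) (FO J [Suc n])"
      "\<theta> (Suc n) \<cdot> FA I ?t \<in> hom C (FO I \<Theta>) (FO J [Suc n])"
      using homs by simp_all
    fix x h b assume h: "h \<in> hom C x (FO I \<Theta>)" and b: "b \<in> hom C x (FO J [0])"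
    have b': "inv_arr C (\<theta> 0) \<cdot> b \<in> hom C x (FO I [0])"
      using b by (simp add: \<theta>_iso)
    define k where "k = inv_arr C (pairing C (FA I ?p) (FA I ?q)) \<cdot> pairing C h (inv_arr C (\<theta> 0) \<cdot> b)"
    have k: "k \<in> hom C x (FO I ?\<Theta>)" and pk: "FA I ?p \<cdot> k = h" and qk: "FA I ?q \<cdot> k = inv_arr C (\<theta> 0) \<cdot> b"
      using I.F_pair[OF h b'] unfolding k_def Snd by blast+
    have \<tau>k: "transf ?\<Theta> \<cdot> k \<in> hom C x (FO J ?\<Theta>)" using k by simp
    have "(FA J ?t \<cdot> transf \<Theta>) \<cdot> h = FA J ?t \<cdot> ((transf \<Theta> \<cdot> FA I ?p) \<cdot> k)"
      unfolding pk[symmetric] using homs k by (simp del: MM_simps)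
    also have "\<dots> = (FA J ?t \<cdot> FA J ?p) \<cdot> (transf ?\<Theta> \<cdot> k)"
      unfolding nat_p[symmetric] using homs k by (simp del: MM_simps)
    finally have 1: "(FA J ?t \<cdot> transf \<Theta>) \<cdot> h = FA J ?t' \<cdot> (transf ?\<Theta> \<cdot> k)"
      unfolding tp .
    have "b = \<theta> 0 \<cdot> (FA I ?q \<cdot> k)"
      unfolding qk using b by (simp add: \<theta>_iso)
    also have "\<dots> = (\<theta> 0 \<cdot> FA I ?q) \<cdot> k"
      using homs k by (simp del: MM_simps)
    also have "\<dots> = FA J ?q \<cdot> (transf ?\<Theta> \<cdot> k)"
      unfolding nat_q[symmetric] using homs k by (simp del: MM_simps)
    finally have 2: "b = FA J ?q \<cdot> (transf ?\<Theta> \<cdot> k)" .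
    have "J.Fev n \<cdot> pairing C ((FA J ?t \<cdot> transf \<Theta>) \<cdot> h) b = FA J ?s \<cdot> (transf ?\<Theta> \<cdot> k)"
      unfolding 1 uncurry_trm_def by (subst 2) (rule J.Fev_pairing[OF t' q \<tau>k])
    also have "\<dots> = (FA J ?s \<cdot> transf ?\<Theta>) \<cdot> k"
      using homs k by simp
    also have "\<dots> = \<theta> n \<cdot> (FA I ?s \<cdot> k)"
      using nat homs k unfolding natural_at_def by simp
    also have "FA I ?s \<cdot> k = I.Fev n \<cdot> pairing C (FA I ?t' \<cdot> k) (FA I ?q \<cdot> k)"
      unfolding uncurry_trm_def by (rule I.Fev_pairing[OF t' q k, symmetric])
    also have "FA I ?t' \<cdot> k = FA I ?t \<cdot> h"
      unfolding tp(1)[symmetric] pk[symmetric] using homs k by (simp del: MM_simps)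
    also have "\<theta> n \<cdot> (I.Fev n \<cdot> pairing C (FA I ?t \<cdot> h) (FA I ?q \<cdot> k)) =
        J.Fev n \<cdot> pairing C (\<theta> (Suc n) \<cdot> (FA I ?t \<cdot> h)) (\<theta> 0 \<cdot> (FA I ?q \<cdot> k))"
      by (rule \<theta>_ev[symmetric]) (use homs h k in simp_all)
    also have "\<theta> 0 \<cdot> (FA I ?q \<cdot> k) = b"
      unfolding qk using b by (simp add: \<theta>_iso)
    also have "\<theta> (Suc n) \<cdot> (FA I ?t \<cdot> h) = (\<theta> (Suc n) \<cdot> FA I ?t) \<cdot> h"
      using homs h by simp
    finally show "J.Fev n \<cdot> pairing C ((FA J ?t \<cdot> transf \<Theta>) \<cdot> h) b =
        J.Fev n \<cdot> pairing C ((\<theta> (Suc n) \<cdot> FA I ?t) \<cdot> h) b" .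
  qed
qed

lemma natural_at_elementary: "elementary \<Theta> n t \<Longrightarrow> natural_at \<Theta> n t"
  by (induction rule: elementary_generated)
    (blast intro: natural_at_gen natural_at_ev natural_at_uncurry)+

lemma naturally_isomorphic: "naturally_isomorphic MM C I J"
  unfolding naturally_isomorphic_def
proof (intro exI conjI ballI)
  fix f assume f: "f \<in> Arr MM"
  then obtain ms ts ns where f': "f = (ms, ts, ns)" by (cases f)
  show "FA J f \<cdot> transf (Dom MM f) = transf (Cod MM f) \<cdot> FA I f"
    using f unfolding f' by (simp only: MM_simps(3,4), intro natural_tuple natural_at_elementary) auto
qed (use transf transf_iso in blast)+

end

lemma naturally_isomorphic_if_iso:
  assumes C: "cartesian_category C"
    and I: "cartesian_functor MM C I" "preserves_exponentiable MM [0] MM_exp MM_ev C I"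
    and J: "cartesian_functor MM C J" "preserves_exponentiable MM [0] MM_exp MM_ev C J"
    and \<theta>0: "iso C \<theta>0" "\<theta>0 \<in> hom C (FO I [0]) (FO J [0])"
  shows "naturally_isomorphic MM C I J"
proof -
  interpret I: MM_functor C I
    using C I by (simp add: MM_functor_def MM_functor_axioms_def)
  interpret J: MM_functor C J
    using C J by (simp add: MM_functor_def MM_functor_axioms_def)
  let ?P = "\<lambda>n \<theta>. (n = 0 \<longrightarrow> \<theta> = \<theta>0) \<and> iso C \<theta> \<and> \<theta> \<in> hom C (FO I [n]) (FO J [n])"
  let ?Q = "\<lambda>n \<theta> \<theta>'. \<forall>x h k. h \<in> hom C x (FO I [Suc n]) \<longrightarrow> k \<in> hom C x (FO I [0]) \<longrightarrow>
    J.Fev n \<cdot>\<^bsub>C\<^esub> pairing C (\<theta>' \<cdot>\<^bsub>C\<^esub> h) (\<theta>0 \<cdot>\<^bsub>C\<^esub> k) = \<theta> \<cdot>\<^bsub>C\<^esub> (I.Fev n \<cdot>\<^bsub>C\<^esub> pairing C h k)"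
  \<comment> \<open>The clause for \<open>n = 0\<close> in \<open>?P\<close> pins down the start, so that \<open>?Q\<close> may mention \<open>\<theta>0\<close> for \<open>\<theta> 0\<close>.\<close>
  have "\<exists>\<theta>. \<forall>n. ?P n (\<theta> n) \<and> ?Q n (\<theta> n) (\<theta> (Suc n))"
  proof (rule dependent_nat_choice)
    show "\<exists>\<theta>. ?P 0 \<theta>" using \<theta>0 by blast
    fix \<theta> n assume \<theta>: "?P n \<theta>"
    then have "iso C \<theta>" "\<theta> \<in> hom C (FO I [n]) (FO J [n])" by blast+
    then show "\<exists>\<theta>'. ?P (Suc n) \<theta>' \<and> ?Q n \<theta> \<theta>'"
      by (rule I.exp_iso[OF I.Fev_exponential J.Fev_exponential _ _ \<theta>0]) blast
  qed
  then obtain \<theta> where PQ: "\<forall>n. ?P n (\<theta> n) \<and> ?Q n (\<theta> n) (\<theta> (Suc n))"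
    by (rule exE)
  have P: "?P n (\<theta> n)" and Q: "?Q n (\<theta> n) (\<theta> (Suc n))" for n
    using spec[OF PQ, of n] by (rule conjunct1, rule conjunct2)
  have "\<theta> 0 = \<theta>0" using P[of 0] by blast
  interpret MM_functor_pair C I J \<theta>
  proof
    fix n show "iso C (\<theta> n)" "\<theta> n \<in> hom C (FO I [n]) (FO J [n])" using P[of n] by blast+
    fix h k x assume "h \<in> hom C x (FO I [Suc n])" "k \<in> hom C x (FO I [0])"
    then show "J.Fev n \<cdot>\<^bsub>C\<^esub> pairing C (\<theta> (Suc n) \<cdot>\<^bsub>C\<^esub> h) (\<theta> 0 \<cdot>\<^bsub>C\<^esub> k) =
        \<theta> n \<cdot>\<^bsub>C\<^esub> (I.Fev n \<cdot>\<^bsub>C\<^esub> pairing C h k)"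
      using Q[of n] unfolding \<open>\<theta> 0 = \<theta>0\<close> by blast
  qed
  show ?thesis by (rule naturally_isomorphic)
qed

text \<open>In the theorem the images of \<open>[0]\<close> are compared only through \<open>D\<close>.\<close>

lemma isomorphic_span:
  assumes "category C" "isomorphic C a c" "isomorphic C b c"
  obtains \<theta> where "iso C \<theta>" "\<theta> \<in> hom C a b"
proof -
  interpret category C by fact
  from assms obtain f g where f: "f \<in> hom C a c" "iso C f" and g: "g \<in> hom C b c" "iso C g"
    unfolding isomorphic_def by blast
  show ?thesis
  proof (rule that)
    show "iso C (inv_arr C g \<cdot>\<^bsub>C\<^esub> f)"
      by (rule iso_comp) (use f g iso_inv_arr in simp_all)
    show "inv_arr C g \<cdot>\<^bsub>C\<^esub> f \<in> hom C a b"
      using f g by simp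
  qed
qed


theorem proposition4p2:
  shows "cartesian_category MM \<and>
    (\<forall>ms \<in> Obj MM. is_exponential MM [0] ms (MM_exp ms) (MM_ev ms)) \<and>
    (\<forall>(\<D> :: ('o, 'a) ccat) D. cartesian_category \<D> \<longrightarrow> exponentiable \<D> D \<longrightarrow>
       (\<exists>I. cartesian_functor MM \<D> I \<and>
            preserves_exponentiable MM [0] MM_exp MM_ev \<D> I \<and>
            isomorphic \<D> (FO I [0]) D) \<and>
       (\<forall>I J.
          cartesian_functor MM \<D> I \<longrightarrow>
          preserves_exponentiable MM [0] MM_exp MM_ev \<D> I \<longrightarrow>
          isomorphic \<D> (FO I [0]) D \<longrightarrow>
          cartesian_functor MM \<D> J \<longrightarrow>
          preserves_exponentiable MM [0] MM_exp MM_ev \<D> J \<longrightarrow>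
          isomorphic \<D> (FO J [0]) D \<longrightarrow>
          naturally_isomorphic MM \<D> I J))"
proof (intro conjI ballI allI impI)
  show "cartesian_category MM" by (rule cartesian_category_MM)
  show "is_exponential MM [0] ms (MM_exp ms) (MM_ev ms)" for ms
    by (rule is_exponential_MM)
  fix \<D> :: "('o, 'a) ccat" and D
  assume C: "cartesian_category \<D>" and D: "exponentiable \<D> D"
  show "\<exists>I. cartesian_functor MM \<D> I \<and> preserves_exponentiable MM [0] MM_exp MM_ev \<D> I \<and>
      isomorphic \<D> (FO I [0]) D"
    by (rule cartesian_functor_ex[OF C D])
  fix I J
  assume I: "cartesian_functor MM \<D> I" "preserves_exponentiable MM [0] MM_exp MM_ev \<D> I"
    and I0: "isomorphic \<D> (FO I [0]) D"
    and J: "cartesian_functor MM \<D> J" "preserves_exponentiable MM [0] MM_exp MM_ev \<D> J"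
    and J0: "isomorphic \<D> (FO J [0]) D"
  have "category \<D>"
    using C by (simp add: cartesian_category_def)
  then obtain \<theta> where "iso \<D> \<theta>" "\<theta> \<in> hom \<D> (FO I [0]) (FO J [0])"
    using isomorphic_span[OF _ I0 J0] by blast
  then show "naturally_isomorphic MM \<D> I J"
    by (rule naturally_isomorphic_if_iso[OF C I J])
qed

end
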